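(* The iterative algorithm (Algorithm 1, described in the context) converges to a solution $(u^*,y_0^* )$ of the fixed point equations $$y_0^*=\mathbb E_{s_0}^{u^*}[R_{0:T}],\qquad u^*\in\operatorname*{argmax}_{u\in\mathcal U^{\rm HD}}\hat J_0^u(s_0,y_0^* ).$$ Furthermore: (i) The policy space $$\mathcal U_{\rm valid}^{\rm HD}(u^* ):=\big\{u\in\mathcal U^{\rm HD}:\ \hat J_0^u(s_0,y_0^* )\ne\hat J_0^{u^*}(s_0,y_0^* )\ \text{for some } s_0\in\mathcal S\big\}\cup\{u^*\}$$ is a valid pruned deterministic policy space. (ii) The algorithm converges to a strictly local optimum $u^*$ in the mixed policy space generated by $\mathcal U_{\rm valid}^{\rm HD}(u^* )$ for the finite-horizon mean-variance MDP with value function $J_0^u(s_0)$, $u\in\{(1-\delta)u'+\delta u'':u',u''\in\mathcal U_{\rm valid}^{\rm HD}(u^* ),\ \delta\in[0,1]\}$. (iii) The algorithm converges to a local optimum $y_0^*$ in the real space of the optimal value function $\hat J_0^*(s_0,y_0)$, $y_0\in\mathcal Y$, of the pseudo mean-variance MDP; i.e. $y_0^*$ is a local maximum point of $\hat J_0^*(s_0,\cdot)$ on $\mathcal Y$.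
   Context: Setting. $\mathcal T=\{0,\ldots,T-1\}$, $T<\infty$; $\mathcal S,\mathcal A$ finite state and action spaces; $\mathcal A(s)\subset\mathcal A$ nonempty admissible action sets, $\cup_s\mathcal A(s)=\mathcal A$; $\mathcal K=\{(s,a):a\in\mathcal A(s)\}$; transition probabilities $P_t(\cdot|s,a)$ on $\mathcal S$; rewards $r_t:\mathcal K\to\mathbb R$ with minimum $\underline r$ and maximum $\bar r$; $\mathcal Y=[T\underline r,T\bar r]$. $\mathcal U^{\rm HR}$ and $\mathcal U^{\rm HD}$ are the sets of history-dependent randomized and deterministic policies (history $h_t=(s_0,a_0,\ldots,s_{t-1},a_{t-1},s_t)$). $R_{0:T}=\sum_{\tau=0}^{T-1}r_\tau(s_\tau,a_\tau)$, $\mu_0^u(s_0)=\mathbb E_{s_0}^u[R_{0:T}]$, $\sigma_0^u(s_0)=\mathbb E_{s_0}^u[(R_{0:T}-\mu_0^u(s_0))^2]$; $\lambda\ge0$ fixed. $J_0^u(s_0)=\mu_0^u(s_0)-\lambda\sigma_0^u(s_0)$ and $J_0^*(s_0)=\sup_{u\in\mathcal U^{\rm HR}}J_0^u(s_0)$ (the finite-horizon mean-variance MDP; $u$ is optimal if $J_0^u(s_0)=J_0^*(s_0)$ for all $s_0$). $\hat J_0^u(s_0,y_0)=\mathbb E_{s_0}^u[R_{0:T}-\lambda(R_{0:T}-y_0)^2]$, $\hat J_0^*(s_0,y_0)=\sup_{u\in\mathcal U^{\rm HR}}\hat J_0^u(s_0,y_0)$; the pseudo mean-variance MDP $\hat{\mathcal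 M}(y_0)$ is the latter maximization. For a given $s_0$, $u$ is optimal for $\hat{\mathcal M}(y_0)$ if it attains $\hat J_0^*(s_0,y_0)$. Dynamic programming. Put $V_T^*(s,y)=-\lambda y^2$ and, for $t=T-1,\ldots,0$, $V_t^*(s,y)=\max_{a\in\mathcal A(s)}\{r_t(s,a)+\sum_{s'}P_t(s'|s,a)V_{t+1}^*(s',y-r_t(s,a))\}$ on $\mathcal S\times\mathbb R$. An inner optimal policy is $\tilde u^*=(\tilde u_t^* )$ where $\tilde u_t^*(s,y)$ attains this maximum. Given $y_0$, it generates $u'\in\mathcal U^{\rm HD}$ by $u'_t(s_0,a_0,\ldots,s_t)=\tilde u_t^*(s_t,y_0-\sum_{\tau=0}^{t-1}r_\tau(s_\tau,a_\tau))$. Break point (for the given $s_0$): $y^c\in\mathcal Y$ such that there exist $y_1<y^c<y_2$ for which the problems $\hat{\mathcal M}(y)$, $y\in[y_1,y^c]$, have the same optimal policy, while this policy is not optimal for $\hat{\mathcal M}(y)$, $y\in(y^c,y_2]$. Algorithm 1 (carried out for each initial state $s_0$; the numbers $y_0^{(k)}$, $y_0^*$ depend on $s_0$). 1. Choose any $u^{(0)}\in\mathcal U^{\rm HD}$, $k\leftarrow0$. 2. Until $u^{(k)}=u^{(k-1)}$, repeat: (Policy evaluation) $y_0^{(k)}=\mathbb E_{s_0}^{u^{(k)}}[R_{0:T}]$. (Policy improvement) Solve $\hat{\mathcal M}(y_0^{(k)})$ by the dynamic programming above, obtain an inner optimal policy $\tilde u^*$ and generate from it, with $y_0=y_0^{(k)}$,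 the policy $u'$; keep $u'=u^{(k)}$ if possible. (Update) $u^{(k+1)}\leftarrow u'$, $k\leftarrow k+1$. 3. When the loop ends, if the current pseudo mean $y_0^{(k)}$ is a break point, return to the policy improvement step and choose another inner optimal policy $\tilde u^{*'}\ne\tilde u^*$ whose generated policy $u''$ satisfies $\hat J_0^{u''}(s_0,\mu_0^{u''}(s_0))>\hat J_0^{u'}(s_0,\mu_0^{u'}(s_0))$; set $u^{(k+1)}\leftarrow u''$, $k\leftarrow k+1$, and return to the policy evaluation step of item 2. 4. Otherwise stop and return $u^*=u^{(k)}$, with associated $y_0^*=\mathbb E_{s_0}^{u^*}[R_{0:T}]$. Mixed policies. For $u,u'\in\mathcal U^{\rm HD}$ and $\delta\in[0,1]$, $\delta_u^{u'}=(1-\delta)u+\delta u'$ is the policy that adopts $u$ with probability $1-\delta$ and $u'$ with probability $\delta$. Valid pruned deterministic policy space: a set $\mathcal U_{\rm valid}^{\rm HD}\subseteq\mathcal U^{\rm HD}$ such that an optimal policy of the finite-horizon mean-variance MDP can be obtained in $\mathcal U_{\rm valid}^{\rm HD}$. Local optimum. Given a valid pruned deterministic policy space $\mathcal U_{\rm valid}^{\rm HD}$, $u\in\mathcal U_{\rm valid}^{\rm HD}$ is locally optimal in the mixed policy space generated by $\mathcal U_{\rm valid}^{\rm HD}$ if there is $\epsilon>0$ with $J_0^u(s_0)\ge J_0^{\delta_u^{u'}}(s_0)$ for all $\delta\in(0,\epsilon)$, $u'\in\mathcal U_{\rm valid}^{\rm HD}$, $s_0\in\mathcal S$. It is a strictly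 local optimum if moreover, for each $u'\in\mathcal U_{\rm valid}^{\rm HD}\setminus\{u\}$, there is $s_0\in\mathcal S$ for which the inequality is strict for all $\delta\in(0,\epsilon)$. *)

theory Defs
  imports "HOL-Probability.Probability"
begin

text \<open>Only stages \<open>t < horizon M\<close> and pairs with \<open>a \<in> adm M s\<close> are meaningful in
  \<open>kern\<close> and \<open>rew\<close>; the values elsewhere are never used.\<close>

record ('s, 'a) mdp =
  horizon :: nat
  adm :: "'s \<Rightarrow> 'a set"
  kern :: "nat \<Rightarrow> 's \<Rightarrow> 'a \<Rightarrow> 's pmf"
  rew :: "nat \<Rightarrow> 's \<Rightarrow> 'a \<Rightarrow> real"
  risk :: real

definition mv_mdp :: "('s::finite, 'a::finite) mdp \<Rightarrow> bool" where
  "mv_mdp M \<longleftrightarrow> horizon M > 0 \<and> (\<forall>s. adm M s \<noteq> {}) \<and> (\<Union>s. adm M s) = UNIV \<and> risk M \<ge> 0"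

definition reward_values :: "('s::finite, 'a::finite) mdp \<Rightarrow> real set" where
  "reward_values M = {rew M t s a | t s a. t < horizon M \<and> a \<in> adm M s}"

definition Y_range :: "('s::finite, 'a::finite) mdp \<Rightarrow> real set" where
  "Y_range M =
    {real (horizon M) * Min (reward_values M) .. real (horizon M) * Max (reward_values M)}"


section \<open>Histories and policies\<close>

text \<open>The history \<open>(s\<^sub>0, a\<^sub>0, \<dots>, s\<^sub>t\<^sub>-\<^sub>1, a\<^sub>t\<^sub>-\<^sub>1, s\<^sub>t)\<close> is the pair of the list
  \<open>[(s\<^sub>0, a\<^sub>0), \<dots>, (s\<^sub>t\<^sub>-\<^sub>1, a\<^sub>t\<^sub>-\<^sub>1)]\<close> and \<open>s\<^sub>t\<close>; the stage \<open>t\<close> is the length of the list.\<close>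

type_synonym ('s, 'a) hist = "('s \<times> 'a) list \<times> 's"
type_synonym ('s, 'a) rpolicy = "('s, 'a) hist \<Rightarrow> 'a pmf"
type_synonym ('s, 'a) dpolicy = "('s, 'a) hist \<Rightarrow> 'a"

definition hists :: "('s::finite, 'a::finite) mdp \<Rightarrow> ('s, 'a) hist set" where
  "hists M = {(l, s). length l < horizon M \<and> (\<forall>(x, a) \<in> set l. a \<in> adm M x)}"

definition init_state :: "('s, 'a) hist \<Rightarrow> 's" where
  "init_state h = (case fst h of [] \<Rightarrow> snd h | (s, a) # _ \<Rightarrow> s)"

definition past_reward :: "('s::finite, 'a::finite) mdp \<Rightarrow> ('s \<times> 'a) list \<Rightarrow> real" where
  "past_reward M l = (\<Sum>\<tau><length l. rew M \<tau> (fst (l ! \<tau>)) (snd (l ! \<tau>)))"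

definition HR :: "('s::finite, 'a::finite) mdp \<Rightarrow> ('s, 'a) rpolicy set" where
  "HR M = (\<Pi> h \<in> hists M. {p. set_pmf p \<subseteq> adm M (snd h)})"

text \<open>Deterministic policies are extensional, so that equality of policies as functions is
  equality on the admissible histories.\<close>

definition HD :: "('s::finite, 'a::finite) mdp \<Rightarrow> ('s, 'a) dpolicy set" where
  "HD M = (\<Pi>\<^sub>E h \<in> hists M. adm M (snd h))"

definition det_policy :: "('s, 'a) dpolicy \<Rightarrow> ('s, 'a) rpolicy" where
  "det_policy u = (\<lambda>h. return_pmf (u h))"


section \<open>Values of policies\<close>

primrec history_pmf ::
  "('s::finite, 'a::finite) mdp \<Rightarrow> ('s, 'a) rpolicy \<Rightarrow> 's \<Rightarrow> nat \<Rightarrow> ('s, 'a) hist pmf" where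
  "history_pmf M u s0 0 = return_pmf ([], s0)"
| "history_pmf M u s0 (Suc t) =
    bind_pmf (history_pmf M u s0 t) (\<lambda>h.
      bind_pmf (u h) (\<lambda>a.
        map_pmf (\<lambda>s'. (fst h @ [(snd h, a)], s')) (kern M t (snd h) a)))"

text \<open>The law of the total reward under a policy. All criteria depend on a policy through this
  law only, so they are defined on laws and apply to mixtures of policies as well.\<close>

definition reward_pmf ::
  "('s::finite, 'a::finite) mdp \<Rightarrow> ('s, 'a) rpolicy \<Rightarrow> 's \<Rightarrow> real pmf" where
  "reward_pmf M u s0 = map_pmf (\<lambda>h. past_reward M (fst h)) (history_pmf M u s0 (horizon M))"

definition law_mv :: "real \<Rightarrow> real pmf \<Rightarrow> real" where
  "law_mv lam p =
    measure_pmf.expectation p (\<lambda>x. x) - lam * measure_pmf.variance p (\<lambda>x. x)"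

definition mean :: "('s::finite, 'a::finite) mdp \<Rightarrow> ('s, 'a) rpolicy \<Rightarrow> 's \<Rightarrow> real" where
  "mean M u s0 = measure_pmf.expectation (reward_pmf M u s0) (\<lambda>x. x)"

definition J :: "('s::finite, 'a::finite) mdp \<Rightarrow> ('s, 'a) rpolicy \<Rightarrow> 's \<Rightarrow> real" where
  "J M u s0 = law_mv (risk M) (reward_pmf M u s0)"

definition J_star :: "('s::finite, 'a::finite) mdp \<Rightarrow> 's \<Rightarrow> real" where
  "J_star M s0 = (SUP u \<in> HR M. J M u s0)"

definition Jhat ::
  "('s::finite, 'a::finite) mdp \<Rightarrow> ('s, 'a) rpolicy \<Rightarrow> 's \<Rightarrow> real \<Rightarrow> real" where
  "Jhat M u s0 y =
    measure_pmf.expectation (reward_pmf M u s0) (\<lambda>x. x - risk M * (x - y)\<^sup>2)"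

definition Jhat_star :: "('s::finite, 'a::finite) mdp \<Rightarrow> 's \<Rightarrow> real \<Rightarrow> real" where
  "Jhat_star M s0 y = (SUP u \<in> HR M. Jhat M u s0 y)"

definition pseudo_optimal ::
  "('s::finite, 'a::finite) mdp \<Rightarrow> 's \<Rightarrow> real \<Rightarrow> ('s, 'a) rpolicy \<Rightarrow> bool" where
  "pseudo_optimal M s0 y u \<longleftrightarrow> u \<in> HR M \<and> Jhat M u s0 y = Jhat_star M s0 y"

text \<open>The end points \<open>y1\<close> and \<open>y2\<close> are arbitrary reals: they need not lie in \<open>Y_range M\<close>.\<close>

definition break_point :: "('s::finite, 'a::finite) mdp \<Rightarrow> 's \<Rightarrow> real \<Rightarrow> bool" where
  "break_point M s0 yc \<longleftrightarrow> yc \<in> Y_range M \<and>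
    (\<exists>y1 y2. y1 < yc \<and> yc < y2 \<and>
      (\<exists>u. (\<forall>y \<in> {y1..yc}. pseudo_optimal M s0 y u) \<and>
           (\<forall>y \<in> {yc<..y2}. \<not> pseudo_optimal M s0 y u)))"


section \<open>Dynamic programming\<close>

definition Q_value ::
  "('s::finite, 'a::finite) mdp \<Rightarrow> nat \<Rightarrow> ('s \<Rightarrow> real \<Rightarrow> real) \<Rightarrow> 's \<Rightarrow> real \<Rightarrow> 'a \<Rightarrow> real" where
  "Q_value M t W s y a =
    rew M t s a + (\<Sum>s'\<in>UNIV. pmf (kern M t s a) s' * W s' (y - rew M t s a))"

text \<open>\<open>V_rem M n\<close> is the optimal value function with \<open>n\<close> stages to go.\<close>

primrec V_rem :: "('s::finite, 'a::finite) mdp \<Rightarrow> nat \<Rightarrow> 's \<Rightarrow> real \<Rightarrow> real" where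
  "V_rem M 0 = (\<lambda>s y. - risk M * y\<^sup>2)"
| "V_rem M (Suc n) =
    (\<lambda>s y. Max (Q_value M (horizon M - Suc n) (V_rem M n) s y ` adm M s))"

definition V_star :: "('s::finite, 'a::finite) mdp \<Rightarrow> nat \<Rightarrow> 's \<Rightarrow> real \<Rightarrow> real" where
  "V_star M t = V_rem M (horizon M - t)"

type_synonym ('s, 'a) ipolicy = "nat \<Rightarrow> 's \<Rightarrow> real \<Rightarrow> 'a"

definition inner_optimal ::
  "('s::finite, 'a::finite) mdp \<Rightarrow> ('s, 'a) ipolicy \<Rightarrow> bool" where
  "inner_optimal M w \<longleftrightarrow> (\<forall>t < horizon M. \<forall>s y.
     w t s y \<in> adm M s \<and> Q_value M t (V_star M (Suc t)) s y (w t s y) = V_star M t s y)"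

definition generated ::
  "('s::finite, 'a::finite) mdp \<Rightarrow> ('s, 'a) ipolicy \<Rightarrow> real \<Rightarrow> ('s, 'a) dpolicy" where
  "generated M w y0 =
    (\<lambda>h \<in> hists M. w (length (fst h)) (snd h) (y0 - past_reward M (fst h)))"


section \<open>The algorithm\<close>

text \<open>A configuration \<open>(p, w, u)\<close> consists of the current policy \<open>u\<close>, the previous policy \<open>p\<close>
  and the inner optimal policy \<open>w\<close> that generated \<open>u\<close>; the latter two are \<open>None\<close> at the start.
  The pseudo mean of a configuration is \<open>mean M (det_policy u) s0\<close>. All choices are nondeterministic.\<close>

type_synonym ('s, 'a) config =
  "('s, 'a) dpolicy option \<times> ('s, 'a) ipolicy option \<times> ('s, 'a) dpolicy"

inductive alg_step ::
  "('s::finite, 'a::finite) mdp \<Rightarrow> 's \<Rightarrow> ('s, 'a) config \<Rightarrow> ('s, 'a) config \<Rightarrow> bool"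
  for M s0 where
  improve:
    "\<lbrakk> p \<noteq> Some u;
       y = mean M (det_policy u) s0;
       inner_optimal M w'; u' = generated M w' y;
       (\<exists>v. inner_optimal M v \<and> generated M v y = u) \<longrightarrow> u' = u \<rbrakk>
     \<Longrightarrow> alg_step M s0 (p, w, u) (Some u, Some w', u')"
| escape:
    "\<lbrakk> y = mean M (det_policy u) s0; break_point M s0 y;
       inner_optimal M w'; w' \<noteq> w; u' = generated M w' y;
       Jhat M (det_policy u') s0 (mean M (det_policy u') s0) > Jhat M (det_policy u) s0 (mean M (det_policy u) s0) \<rbrakk>
     \<Longrightarrow> alg_step M s0 (Some u, Some w, u) (Some u, Some w', u')"

definition alg_start :: "('s, 'a) dpolicy \<Rightarrow> ('s, 'a) config" where
  "alg_start u = (None, None, u)"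

definition alg_halted :: "('s::finite, 'a::finite) mdp \<Rightarrow> 's \<Rightarrow> ('s, 'a) config \<Rightarrow> bool" where
  "alg_halted M s0 c \<longleftrightarrow>
    (case c of (p, w, u) \<Rightarrow> p = Some u \<and> \<not> break_point M s0 (mean M (det_policy u) s0))"

text \<open>Every run from \<open>u0\<close>, whatever the choices, is finite and can only end by halting; in
  particular the choice demanded at a break point is always possible.\<close>

definition alg_terminates ::
  "('s::finite, 'a::finite) mdp \<Rightarrow> 's \<Rightarrow> ('s, 'a) dpolicy \<Rightarrow> bool" where
  "alg_terminates M s0 u0 \<longleftrightarrow>
    (\<nexists>c. c 0 = alg_start u0 \<and> (\<forall>k::nat. alg_step M s0 (c k) (c (Suc k)))) \<and>
    (\<forall>c. (alg_step M s0)\<^sup>*\<^sup>* (alg_start u0) c \<longrightarrow> alg_halted M s0 c \<or> (\<exists>c'. alg_step M s0 c c'))"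

definition alg_returns ::
  "('s::finite, 'a::finite) mdp \<Rightarrow> 's \<Rightarrow> ('s, 'a) dpolicy \<Rightarrow> ('s, 'a) dpolicy \<Rightarrow> real \<Rightarrow> bool" where
  "alg_returns M s0 u0 u y \<longleftrightarrow>
    (\<exists>p w. (alg_step M s0)\<^sup>*\<^sup>* (alg_start u0) (p, w, u) \<and> alg_halted M s0 (p, w, u)) \<and>
    y = mean M (det_policy u) s0"

text \<open>The algorithm is run separately for every initial state. A run for \<open>s0\<close> concerns only the
  histories that start in \<open>s0\<close>, so the runs together yield one policy.\<close>

definition assemble ::
  "('s::finite, 'a::finite) mdp \<Rightarrow> ('s \<Rightarrow> ('s, 'a) dpolicy) \<Rightarrow> ('s, 'a) dpolicy" where
  "assemble M v = (\<lambda>h \<in> hists M. v (init_state h) h)"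


section \<open>Pruned policy spaces and mixed policies\<close>

definition valid_pruned ::
  "('s::finite, 'a::finite) mdp \<Rightarrow> ('s, 'a) dpolicy set \<Rightarrow> bool" where
  "valid_pruned M U \<longleftrightarrow> U \<subseteq> HD M \<and> (\<exists>u \<in> U. \<forall>s0. J M (det_policy u) s0 = J_star M s0)"

definition U_valid ::
  "('s::finite, 'a::finite) mdp \<Rightarrow> ('s, 'a) dpolicy \<Rightarrow> ('s \<Rightarrow> real) \<Rightarrow> ('s, 'a) dpolicy set" where
  "U_valid M ustar ystar =
    {u \<in> HD M. \<exists>s0. Jhat M (det_policy u) s0 (ystar s0) \<noteq> Jhat M (det_policy ustar) s0 (ystar s0)} \<union> {ustar}"

text \<open>A mixed policy draws one of two policies at the outset, with probability \<open>\<delta>\<close> the second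
  one, and then follows it.\<close>

definition J_mixed ::
  "('s::finite, 'a::finite) mdp \<Rightarrow> real \<Rightarrow> ('s, 'a) dpolicy \<Rightarrow> ('s, 'a) dpolicy \<Rightarrow> 's \<Rightarrow> real" where
  "J_mixed M \<delta> u u' s0 = law_mv (risk M)
    (bind_pmf (bernoulli_pmf \<delta>) (\<lambda>b. reward_pmf M (det_policy (if b then u' else u)) s0))"

text \<open>The bound \<open>\<epsilon> \<le> 1\<close> keeps \<open>\<delta>\<close> in the unit interval.\<close>

definition local_opt_radius ::
  "('s::finite, 'a::finite) mdp \<Rightarrow> ('s, 'a) dpolicy set \<Rightarrow> ('s, 'a) dpolicy \<Rightarrow> real \<Rightarrow> bool" where
  "local_opt_radius M U u \<epsilon> \<longleftrightarrow> 0 < \<epsilon> \<and> \<epsilon> \<le> 1 \<and>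
    (\<forall>\<delta> \<in> {0<..<\<epsilon>}. \<forall>u' \<in> U. \<forall>s0. J M (det_policy u) s0 \<ge> J_mixed M \<delta> u u' s0)"

definition strictly_local_opt ::
  "('s::finite, 'a::finite) mdp \<Rightarrow> ('s, 'a) dpolicy set \<Rightarrow> ('s, 'a) dpolicy \<Rightarrow> bool" where
  "strictly_local_opt M U u \<longleftrightarrow> u \<in> U \<and>
    (\<exists>\<epsilon>. local_opt_radius M U u \<epsilon> \<and>
      (\<forall>u' \<in> U - {u}. \<exists>s0. \<forall>\<delta> \<in> {0<..<\<epsilon>}. J M (det_policy u) s0 > J_mixed M \<delta> u u' s0))"

definition local_max_on :: "real set \<Rightarrow> (real \<Rightarrow> real) \<Rightarrow> real \<Rightarrow> bool" where
  "local_max_on Y f y0 \<longleftrightarrow> y0 \<in> Y \<and> (\<exists>\<epsilon>>0. \<forall>y \<in> Y. \<bar>y - y0\<bar> < \<epsilon> \<longrightarrow> f y \<le> f y0)"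

end

theory Submission
  imports Defs
begin

text \<open>As a function of \<open>y\<close>, each \<open>Jhat\<close> is the parabola \<open>J - risk * (mean - y)\<^sup>2\<close>, so the difference of two
  of them is affine and \<open>Jhat_star\<close> plus \<open>risk * y\<^sup>2\<close> is a finite maximum of lines whose slopes are
  given by the means. At the mean of a policy \<open>Jhat\<close> equals \<open>J\<close>, so an improvement step raises \<open>J\<close>
  unless it fixes the mean, after which the policy is kept; hence runs are finite. By continuity of
  the value functions, a policy generated frequently along a one-sided approach to a point is
  generated at that point as well: at a break point this yields two generated policies with
  different means, one of which has a larger \<open>J\<close>. Where no break occurs, one policy is optimal on a
  whole neighbourhood, so every optimal policy has the same mean and \<open>Jhat_star\<close> is locally the
  parabola with its peak at that mean. Mixing costs the gap to optimality in first order and gains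
  from the change of the mean only in second order.\<close>

section \<open>Expectations under finitely supported laws, limits and finite maxima\<close>

lemma expectation_bind_finite:
  fixes g :: "'b \<Rightarrow> real"
  assumes "finite (set_pmf p)" "\<And>x. x \<in> set_pmf p \<Longrightarrow> finite (set_pmf (f x))"
  shows "measure_pmf.expectation (bind_pmf p f) g =
    measure_pmf.expectation p (\<lambda>x. measure_pmf.expectation (f x) g)"
  using assms by (simp add: pmf_expectation_bind[of "set_pmf p"] integral_measure_pmf[of "set_pmf p"])

lemma expectation_mono_finite:
  fixes f g :: "'b \<Rightarrow> real"
  assumes "finite (set_pmf p)" "\<And>x. x \<in> set_pmf p \<Longrightarrow> f x \<le> g x"
  shows "measure_pmf.expectation p f \<le> measure_pmf.expectation p g"
  using assms by (intro integral_mono_AE integrable_measure_pmf_finite) (auto simp: AE_measure_pmf_iff)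

lemma expectation_cong_pmf:
  fixes f g :: "'b \<Rightarrow> real"
  assumes "\<And>x. x \<in> set_pmf p \<Longrightarrow> f x = g x"
  shows "measure_pmf.expectation p f = measure_pmf.expectation p g"
  using assms by (intro integral_cong_AE) (auto simp: AE_measure_pmf_iff)

text \<open>The second moment about \<open>y\<close> is the variance plus the squared distance of
  \<open>y\<close> from the mean. This is what makes every \<open>Jhat\<close> a parabola in the
  pseudo mean.\<close>

lemma expectation_penalty:
  fixes p :: "real pmf"
  assumes "finite (set_pmf p)"
  shows "measure_pmf.expectation p (\<lambda>x. x - c * (x - y)\<^sup>2) =
    law_mv c p - c * (measure_pmf.expectation p (\<lambda>x. x) - y)\<^sup>2"
proof -
  have int: "integrable (measure_pmf p) f" for f :: "real \<Rightarrow> real"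
    using assms by (rule integrable_measure_pmf_finite)
  define m where "m = measure_pmf.expectation p (\<lambda>x. x)"
  \<comment> \<open>The square is expanded about the mean \<open>m\<close>; the cross term produces
    the coefficient of \<open>x\<close> and part of the constant.\<close>
  have "measure_pmf.expectation p (\<lambda>x. x - c * (x - y)\<^sup>2) = measure_pmf.expectation p
      (\<lambda>x. (1 - 2 * c * (m - y)) * x - c * (x - m)\<^sup>2 + c * (m\<^sup>2 - y\<^sup>2))"
    by (rule expectation_cong_pmf) (simp add: power2_eq_square algebra_simps)
  also have "\<dots> = (1 - 2 * c * (m - y)) * m -
      c * measure_pmf.expectation p (\<lambda>x. (x - m)\<^sup>2) + c * (m\<^sup>2 - y\<^sup>2)"
    unfolding m_def
    by (simp only: Bochner_Integration.integral_add Bochner_Integration.integral_diff int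
        integral_mult_right_zero measure_pmf.prob_space lebesgue_integral_const) (simp add: measure_pmf.prob_space)
  also have "\<dots> = law_mv c p - c * (m - y)\<^sup>2"
    unfolding law_mv_def m_def[symmetric] by (simp add: power2_eq_square algebra_simps)
  finally show ?thesis unfolding m_def .
qed

text \<open>A nonzero limit of the difference would keep it nonzero eventually along
  \<open>F\<close>. The filter may leave out \<open>c\<close>, as the one-sided filters at
  \<open>c\<close> do.\<close>

lemma frequently_eq_limit:
  fixes f g :: "real \<Rightarrow> real"
  assumes "frequently (\<lambda>y. f y = g y) F" "F \<le> nhds c" "isCont f c" "isCont g c"
  shows "f c = g c"
proof (rule ccontr)
  assume "f c \<noteq> g c"
  have "((\<lambda>y. f y - g y) \<longlongrightarrow> f c - g c) (nhds c)"
    using assms(3,4) by (intro tendsto_diff) (auto simp: isCont_def tendsto_at_iff_tendsto_nhds)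
  then have "((\<lambda>y. f y - g y) \<longlongrightarrow> f c - g c) F"
    by (rule tendsto_mono[OF assms(2)])
  then have "eventually (\<lambda>y. f y - g y \<noteq> 0) F"
    using \<open>f c \<noteq> g c\<close> by (intro tendsto_imp_eventually_ne) auto
  then have "eventually (\<lambda>y. f y \<noteq> g y) F" by (rule eventually_mono) simp
  with assms(1) show False by (simp add: frequently_def)
qed

lemma continuous_on_Max:
  fixes f :: "'b \<Rightarrow> 'c::topological_space \<Rightarrow> real"
  assumes "finite A" "A \<noteq> {}" "\<And>a. a \<in> A \<Longrightarrow> continuous_on S (f a)"
  shows "continuous_on S (\<lambda>x. Max ((\<lambda>a. f a x) ` A))"
  using assms
proof (induction rule: finite_ne_induct)
  case (singleton a)
  then show ?case by simp
next
  case (insert a A)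
  then have "continuous_on S (\<lambda>x. max (f a x) (Max ((\<lambda>a. f a x) ` A)))"
    by (intro continuous_on_max) auto
  with insert show ?case by simp
qed

section \<open>Histories, policies and laws of the total reward\<close>

lemma past_reward_snoc:
  "past_reward M (l @ [(s, a)]) = past_reward M l + rew M (length l) s a"
  unfolding past_reward_def by (simp add: nth_append)

lemma finite_history_pmf: "finite (set_pmf (history_pmf M u s0 t))"
  by (induction t) auto

lemma finite_reward_pmf: "finite (set_pmf (reward_pmf M u s0))"
  unfolding reward_pmf_def by (simp add: finite_history_pmf)

lemma Jhat_eq_J: "Jhat M u s0 y = J M u s0 - risk M * (mean M u s0 - y)\<^sup>2"
  unfolding Jhat_def J_def mean_def by (rule expectation_penalty[OF finite_reward_pmf])

lemma finite_hists: "finite (hists M)"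
proof -
  have "hists M \<subseteq> {l. set l \<subseteq> UNIV \<and> length l \<le> horizon M} \<times> UNIV"
    by (auto simp: hists_def)
  then show ?thesis by (rule finite_subset) (intro finite_cartesian_product finite_lists_length_le, auto)
qed

lemma finite_HD: "finite (HD M)"
  unfolding HD_def by (intro finite_PiE finite_hists) auto

lemma det_policy_HR: "u \<in> HD M \<Longrightarrow> det_policy u \<in> HR M"
  unfolding HD_def HR_def det_policy_def by (auto dest: PiE_mem)

lemma history_pmf_support:
  assumes "u \<in> HR M" "t \<le> horizon M" "h \<in> set_pmf (history_pmf M u s0 t)"
  shows "length (fst h) = t \<and> (\<forall>(x, a) \<in> set (fst h). a \<in> adm M x) \<and> init_state h = s0"
  using assms(2,3)
proof (induction t arbitrary: h)
  case 0
  then show ?case by (simp add: init_state_def)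
next
  case (Suc t)
  then obtain g a s where g: "g \<in> set_pmf (history_pmf M u s0 t)" and a: "a \<in> set_pmf (u g)"
    and h: "h = (fst g @ [(snd g, a)], s)" by auto
  have IH: "length (fst g) = t" "\<forall>(x, a) \<in> set (fst g). a \<in> adm M x" "init_state g = s0"
    using Suc.IH[OF _ g] Suc.prems by auto
  have "g \<in> hists M" using IH Suc.prems unfolding hists_def by (cases g) auto
  with assms(1) a have "a \<in> adm M (snd g)" unfolding HR_def by blast
  with IH h show ?case
    unfolding init_state_def by (auto split: list.splits)
qed

lemma history_pmf_hists:
  assumes "u \<in> HR M" "t < horizon M" "h \<in> set_pmf (history_pmf M u s0 t)"
  shows "h \<in> hists M" "length (fst h) = t" "init_state h = s0"
  using history_pmf_support[OF assms(1) _ assms(3)] assms(2) unfolding hists_def by (cases h; auto)+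

text \<open>By induction on the stage the history laws coincide, since only admissible histories
  that start in \<open>s0\<close> are ever reached. This separates the runs for different initial
  states.\<close>

lemma reward_pmf_cong:
  assumes "u \<in> HR M" "\<And>h. h \<in> hists M \<Longrightarrow> init_state h = s0 \<Longrightarrow> u h = u' h"
  shows "reward_pmf M u s0 = reward_pmf M u' s0"
proof -
  have "history_pmf M u s0 t = history_pmf M u' s0 t" if "t \<le> horizon M" for t
    using that
  proof (induction t)
    case (Suc t)
    have "bind_pmf (history_pmf M u s0 t) (\<lambda>h. bind_pmf (u h) (\<lambda>a.
        map_pmf (\<lambda>s'. (fst h @ [(snd h, a)], s')) (kern M t (snd h) a))) =
      bind_pmf (history_pmf M u s0 t) (\<lambda>h. bind_pmf (u' h) (\<lambda>a.
        map_pmf (\<lambda>s'. (fst h @ [(snd h, a)], s')) (kern M t (snd h) a)))"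
    proof (intro bind_pmf_cong refl)
      fix h assume "h \<in> set_pmf (history_pmf M u s0 t)"
      then have "h \<in> hists M" "init_state h = s0"
        using Suc.prems history_pmf_hists(1,3)[OF assms(1), of t h s0] by simp_all
      then show "u h = u' h" by (rule assms(2))
    qed
    with Suc show ?case by simp
  qed simp
  then show ?thesis unfolding reward_pmf_def by simp
qed

lemma assemble_HD:
  assumes "\<And>s. v s \<in> HD M"
  shows "assemble M v \<in> HD M"
  using assms unfolding assemble_def HD_def by (auto simp: PiE_def Pi_def extensional_def)

lemma reward_pmf_assemble:
  assumes "\<And>s. v s \<in> HD M"
  shows "reward_pmf M (det_policy (assemble M v)) s0 = reward_pmf M (det_policy (v s0)) s0"
  by (rule reward_pmf_cong[OF det_policy_HR[OF assemble_HD[OF assms]]])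
    (simp add: assemble_def det_policy_def)

section \<open>Dynamic programming as a bound and its attainment\<close>

lemma V_star_rec:
  assumes "t < horizon M"
  shows "V_star M t s y = Max (Q_value M t (V_star M (Suc t)) s y ` adm M s)"
proof -
  have "horizon M - t = Suc (horizon M - Suc t)" "horizon M - Suc (horizon M - Suc t) = t"
    using assms by auto
  then show ?thesis unfolding V_star_def by simp
qed

text \<open>The expected total when the stages from \<open>t\<close> on are played optimally instead of by \<open>u\<close>.\<close>

definition stage_value ::
  "('s::finite, 'a::finite) mdp \<Rightarrow> ('s, 'a) rpolicy \<Rightarrow> 's \<Rightarrow> real \<Rightarrow> nat \<Rightarrow> real" where
  "stage_value M u s0 y t = measure_pmf.expectation (history_pmf M u s0 t)
    (\<lambda>h. past_reward M (fst h) + V_star M t (snd h) (y - past_reward M (fst h)))"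

lemma stage_value_horizon: "stage_value M u s0 y (horizon M) = Jhat M u s0 y"
proof -
  have "(\<lambda>h :: ('a, 'b) hist. past_reward M (fst h) - risk M * (y - past_reward M (fst h))\<^sup>2) =
    (\<lambda>h. past_reward M (fst h) - risk M * (past_reward M (fst h) - y)\<^sup>2)"
    by (simp add: power2_commute)
  then show ?thesis
    unfolding stage_value_def Jhat_def reward_pmf_def V_star_def by simp
qed

lemma stage_value_0: "stage_value M u s0 y 0 = V_star M 0 s0 y"
  unfolding stage_value_def past_reward_def by simp

text \<open>The reward of stage \<open>t\<close> moves from the second argument of the value
  function into the past reward, so averaging over the next state leaves exactly
  \<open>Q_value\<close>.\<close>

lemma stage_value_Suc:
  assumes "u \<in> HR M" "t < horizon M"
  shows "stage_value M u s0 y (Suc t) = measure_pmf.expectation (history_pmf M u s0 t)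
    (\<lambda>h. measure_pmf.expectation (u h) (\<lambda>a. past_reward M (fst h) +
      Q_value M t (V_star M (Suc t)) (snd h) (y - past_reward M (fst h)) a))"
proof -
  let ?g = "\<lambda>h. past_reward M (fst h) + V_star M (Suc t) (snd h) (y - past_reward M (fst h))"
  have inner: "measure_pmf.expectation
        (map_pmf (\<lambda>s'. (fst h @ [(snd h, a)], s')) (kern M t (snd h) a)) ?g =
      past_reward M (fst h) + Q_value M t (V_star M (Suc t)) (snd h) (y - past_reward M (fst h)) a"
    if "h \<in> set_pmf (history_pmf M u s0 t)" for h a
  proof -
    have "length (fst h) = t" using history_pmf_hists[OF assms that] by simp
    then show ?thesis
      \<comment> \<open>The weights sum to one, which takes the rewards out of the sum over the next
        state.\<close>
      using sum_pmf_eq_1[of UNIV "kern M t (snd h) a"]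
      by (simp add: past_reward_snoc integral_measure_pmf_real[of UNIV] Q_value_def
          algebra_simps sum.distrib flip: sum_distrib_left sum_distrib_right)
  qed
  have "stage_value M u s0 y (Suc t) = measure_pmf.expectation (history_pmf M u s0 t)
    (\<lambda>h. measure_pmf.expectation (u h) (\<lambda>a. measure_pmf.expectation
        (map_pmf (\<lambda>s'. (fst h @ [(snd h, a)], s')) (kern M t (snd h) a)) ?g))"
    unfolding stage_value_def history_pmf.simps
    by (subst expectation_bind_finite)
      (auto simp: finite_history_pmf simp del: integral_map_pmf intro!: expectation_cong_pmf expectation_bind_finite)
  also have "\<dots> = measure_pmf.expectation (history_pmf M u s0 t)
    (\<lambda>h. measure_pmf.expectation (u h) (\<lambda>a. past_reward M (fst h) +
      Q_value M t (V_star M (Suc t)) (snd h) (y - past_reward M (fst h)) a))"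
    by (intro expectation_cong_pmf inner)
  finally show ?thesis .
qed

text \<open>An average of \<open>Q_value\<close> over admissible actions is at most its maximum, so
  handing one more stage over to optimal play cannot hurt.\<close>

lemma stage_value_Suc_le:
  assumes "u \<in> HR M" "t < horizon M"
  shows "stage_value M u s0 y (Suc t) \<le> stage_value M u s0 y t"
  unfolding stage_value_Suc[OF assms] unfolding stage_value_def
proof (rule expectation_mono_finite[OF finite_history_pmf])
  fix h assume "h \<in> set_pmf (history_pmf M u s0 t)"
  then have "h \<in> hists M" using history_pmf_hists[OF assms] by simp
  then have adm: "set_pmf (u h) \<subseteq> adm M (snd h)" using assms(1) unfolding HR_def by blast
  let ?r = "past_reward M (fst h) + V_star M t (snd h) (y - past_reward M (fst h))"
  have "measure_pmf.expectation (u h) (\<lambda>a. past_reward M (fst h) +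
        Q_value M t (V_star M (Suc t)) (snd h) (y - past_reward M (fst h)) a)
      \<le> measure_pmf.expectation (u h) (\<lambda>a. ?r)"
    by (rule expectation_mono_finite) (use adm in \<open>auto simp: V_star_rec[OF assms(2)]\<close>)
  then show "measure_pmf.expectation (u h) (\<lambda>a. past_reward M (fst h) +
        Q_value M t (V_star M (Suc t)) (snd h) (y - past_reward M (fst h)) a) \<le> ?r" by simp
qed

lemma Jhat_le_V_star:
  assumes "u \<in> HR M"
  shows "Jhat M u s0 y \<le> V_star M 0 s0 y"
proof -
  have "stage_value M u s0 y t \<le> stage_value M u s0 y 0" if "t \<le> horizon M" for t
    using that
  proof (induction t)
    case (Suc t)
    then show ?case using stage_value_Suc_le[OF assms, of t s0 y] by simp
  qed simp
  then show ?thesis by (metis order_refl stage_value_horizon stage_value_0)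
qed

text \<open>The maximum of dynamic programming is attained at every admissible history, reached or
  not. For a fixed policy these are finitely many equations in \<open>y\<close>, which makes the
  condition stable under limits in \<open>y\<close>.\<close>

definition conserving :: "('s::finite, 'a::finite) mdp \<Rightarrow> real \<Rightarrow> ('s, 'a) dpolicy \<Rightarrow> bool" where
  "conserving M y u \<longleftrightarrow> (\<forall>h \<in> hists M.
    Q_value M (length (fst h)) (V_star M (Suc (length (fst h)))) (snd h)
      (y - past_reward M (fst h)) (u h) =
    V_star M (length (fst h)) (snd h) (y - past_reward M (fst h)))"

text \<open>Along a conserving policy each inequality between consecutive stage values becomes an
  equality.\<close>

lemma Jhat_conserving:
  assumes "u \<in> HD M" "conserving M y u"
  shows "Jhat M (det_policy u) s0 y = V_star M 0 s0 y"
proof -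
  note HR = det_policy_HR[OF assms(1)]
  have "stage_value M (det_policy u) s0 y t = stage_value M (det_policy u) s0 y 0"
    if "t \<le> horizon M" for t
    using that
  proof (induction t)
    case (Suc t)
    then have t: "t < horizon M" by simp
    have "stage_value M (det_policy u) s0 y (Suc t) = stage_value M (det_policy u) s0 y t"
      unfolding stage_value_Suc[OF HR t] unfolding stage_value_def
    proof (rule expectation_cong_pmf)
      fix h assume h: "h \<in> set_pmf (history_pmf M (det_policy u) s0 t)"
      show "measure_pmf.expectation (det_policy u h) (\<lambda>a. past_reward M (fst h) +
          Q_value M t (V_star M (Suc t)) (snd h) (y - past_reward M (fst h)) a) =
        past_reward M (fst h) + V_star M t (snd h) (y - past_reward M (fst h))"
        using bspec[OF assms(2)[unfolded conserving_def] history_pmf_hists(1)[OF HR t h]]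
          history_pmf_hists(2)[OF HR t h]
        by (simp add: det_policy_def)
    qed
    with Suc t show ?case by simp
  qed simp
  then show ?thesis by (metis order_refl stage_value_horizon stage_value_0)
qed

section \<open>Generated policies and configurations of the algorithm\<close>

definition greedy :: "('s::finite, 'a::finite) mdp \<Rightarrow> real \<Rightarrow> ('s, 'a) dpolicy \<Rightarrow> bool" where
  "greedy M y u \<longleftrightarrow> (\<exists>w. inner_optimal M w \<and> generated M w y = u)"

definition reward_markov :: "('s::finite, 'a::finite) mdp \<Rightarrow> ('s, 'a) dpolicy \<Rightarrow> bool" where
  "reward_markov M u \<longleftrightarrow> (\<forall>h \<in> hists M. \<forall>h' \<in> hists M. length (fst h) = length (fst h') \<longrightarrow>
    snd h = snd h' \<longrightarrow> past_reward M (fst h) = past_reward M (fst h') \<longrightarrow> u h = u h')"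

lemma generated_HD:
  assumes "inner_optimal M w"
  shows "generated M w y \<in> HD M"
  using assms unfolding inner_optimal_def generated_def HD_def hists_def by auto

lemma generated_conserving:
  assumes "inner_optimal M w"
  shows "conserving M y (generated M w y)"
  using assms unfolding inner_optimal_def generated_def conserving_def hists_def by auto


text \<open>The invariant of the runs. Once the previous policy equals the current one, it says that
  the current policy is generated at its own mean.\<close>

definition coherent :: "('s::finite, 'a::finite) mdp \<Rightarrow> 's \<Rightarrow> ('s, 'a) config \<Rightarrow> bool" where
  "coherent M s0 c \<longleftrightarrow> (case c of (p, w, u) \<Rightarrow> u \<in> HD M \<and>
    (\<forall>q. p = Some q \<longrightarrow> (\<exists>w'. w = Some w' \<and> inner_optimal M w' \<and>
      u = generated M w' (mean M (det_policy q) s0))))"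

text \<open>An improvement step may keep the value when the current policy is optimal but not generated
  by an inner optimal policy; the phase then drops, so the pair decreases lexicographically.\<close>

definition phase :: "('s::finite, 'a::finite) mdp \<Rightarrow> 's \<Rightarrow> ('s, 'a) config \<Rightarrow> nat" where
  "phase M s0 c = (case c of (p, w, u) \<Rightarrow>
    if p = Some u then 0 else if greedy M (mean M (det_policy u) s0) u then 1 else 2)"

text \<open>The lexicographic order in a single number: the phase is at most 2, so the factor 3 lets
  the loss of one better policy outweigh any rise of the phase.\<close>

definition potential :: "('s::finite, 'a::finite) mdp \<Rightarrow> 's \<Rightarrow> ('s, 'a) config \<Rightarrow> nat" where
  "potential M s0 c = (case c of (p, w, u) \<Rightarrow>
    3 * card {v \<in> HD M. J M (det_policy u) s0 < J M (det_policy v) s0} + phase M s0 c)"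

section \<open>Existence and characterization of generated policies\<close>

context
  fixes M :: "('s::finite, 'a::finite) mdp"
  assumes mv: "mv_mdp M"
begin

lemma adm_nonempty: "adm M s \<noteq> {}" and risk_nonneg: "0 \<le> risk M"
  using mv unfolding mv_mdp_def by auto

lemma inner_optimal_exists: "\<exists>w. inner_optimal M w"
proof -
  have "\<exists>a. a \<in> adm M s \<and> (t < horizon M \<longrightarrow> Q_value M t (V_star M (Suc t)) s y a = V_star M t s y)"
    for t s y
  proof -
    have "Max (Q_value M t (V_star M (Suc t)) s y ` adm M s) \<in> Q_value M t (V_star M (Suc t)) s y ` adm M s"
      using adm_nonempty by (intro Max_in) auto
    then show ?thesis by (auto simp: V_star_rec)
  qed
  note ex = this
  have "inner_optimal M (\<lambda>t s y. SOME a. a \<in> adm M s \<and>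
      (t < horizon M \<longrightarrow> Q_value M t (V_star M (Suc t)) s y a = V_star M t s y))"
    unfolding inner_optimal_def
  proof (intro allI impI)
    fix t s y assume "t < horizon M"
    with someI_ex[OF ex[of s t y]] show "(SOME a. a \<in> adm M s \<and>
      (t < horizon M \<longrightarrow> Q_value M t (V_star M (Suc t)) s y a = V_star M t s y)) \<in> adm M s \<and>
      Q_value M t (V_star M (Suc t)) s y (SOME a. a \<in> adm M s \<and>
      (t < horizon M \<longrightarrow> Q_value M t (V_star M (Suc t)) s y a = V_star M t s y)) = V_star M t s y"
      by blast
  qed
  then show ?thesis by (rule exI[of "inner_optimal M"])
qed

lemma greedy_exists: "\<exists>u. greedy M y u"
  using inner_optimal_exists unfolding greedy_def by auto

text \<open>An inner policy sees only stage, state and pseudo reward, which for fixed \<open>y\<close> is the past reward.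
  The right-hand side mentions \<open>y\<close> only through an equation continuous in \<open>y\<close>.\<close>

lemma greedy_iff: "greedy M y u \<longleftrightarrow> u \<in> HD M \<and> reward_markov M u \<and> conserving M y u"
proof
  assume "greedy M y u"
  then show "u \<in> HD M \<and> reward_markov M u \<and> conserving M y u"
  proof -
    obtain w where w: "inner_optimal M w" "generated M w y = u"
      using \<open>greedy M y u\<close> unfolding greedy_def by blast
    have "reward_markov M (generated M w y)"
      unfolding reward_markov_def generated_def by simp
    with w generated_HD[OF w(1), of y] generated_conserving[OF w(1), of y] show ?thesis by simp
  qed
next
  assume u: "u \<in> HD M \<and> reward_markov M u \<and> conserving M y u"
  obtain w0 where w0: "inner_optimal M w0" using inner_optimal_exists by blast
  define ok where "ok t s x a \<longleftrightarrow>
    a \<in> adm M s \<and> Q_value M t (V_star M (Suc t)) s x a = V_star M t s x" for t s x a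
  \<comment> \<open>From the initial pseudo reward \<open>y\<close>, the history \<open>h\<close>
    confronts the inner policy with the arguments \<open>t\<close>, \<open>s\<close>,
    \<open>x\<close>.\<close>
  define matches where "matches t s x h \<longleftrightarrow>
    h \<in> hists M \<and> length (fst h) = t \<and> snd h = s \<and> y - past_reward M (fst h) = x" for t s x h
  have ok_u: "ok t s x (u h)" if "matches t s x h" for t s x h
  proof -
    have h: "h \<in> hists M" using that unfolding matches_def by simp
    have "u h \<in> adm M (snd h)" using u h unfolding HD_def by (blast dest: PiE_mem)
    moreover have "Q_value M (length (fst h)) (V_star M (Suc (length (fst h)))) (snd h)
        (y - past_reward M (fst h)) (u h) =
      V_star M (length (fst h)) (snd h) (y - past_reward M (fst h))"
      using u h unfolding conserving_def by blast
    ultimately show ?thesis using that unfolding matches_def ok_def by blast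
  qed
  have same: "u h = u h'" if "matches t s x h" "matches t s x h'" for t s x h h'
  proof -
    have "past_reward M (fst h) = past_reward M (fst h')"
      using that unfolding matches_def by linarith
    then show ?thesis using that u unfolding matches_def reward_markov_def by metis
  qed
  \<comment> \<open>The inner policy follows \<open>u\<close> wherever some history arrives, where
    \<open>reward_markov\<close> removes any conflict; everywhere else \<open>w0\<close> supplies a
    maximizer.\<close>
  have "\<exists>a. (t < horizon M \<longrightarrow> ok t s x a) \<and> (\<forall>h. matches t s x h \<longrightarrow> u h = a)" for t s x
  proof (cases "\<exists>h. matches t s x h")
    case True
    then obtain h where "matches t s x h" ..
    then show ?thesis using ok_u same by blast
  next
    case False
    moreover have "t < horizon M \<longrightarrow> ok t s x (w0 t s x)"
      using w0 unfolding inner_optimal_def ok_def by blast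
    ultimately show ?thesis by blast
  qed
  note ex = this
  define w where "w t s x =
    (SOME a. (t < horizon M \<longrightarrow> ok t s x a) \<and> (\<forall>h. matches t s x h \<longrightarrow> u h = a))" for t s x
  have w: "(t < horizon M \<longrightarrow> ok t s x (w t s x)) \<and> (\<forall>h. matches t s x h \<longrightarrow> u h = w t s x)"
    for t s x
    unfolding w_def by (rule someI_ex[OF ex])
  have "inner_optimal M w"
    using w unfolding inner_optimal_def ok_def by blast
  moreover have "generated M w y = u"
  proof (rule ext)
    fix h
    show "generated M w y h = u h"
    proof (cases "h \<in> hists M")
      case True
      then have "matches (length (fst h)) (snd h) (y - past_reward M (fst h)) h"
        unfolding matches_def by blast
      then have "u h = w (length (fst h)) (snd h) (y - past_reward M (fst h))" using w by blast
      with True show ?thesis by (simp add: generated_def)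
    next
      case False
      have "u \<in> (\<Pi>\<^sub>E h \<in> hists M. adm M (snd h))" using u unfolding HD_def by blast
      from PiE_arb[OF this False] False show ?thesis by (simp add: generated_def)
    qed
  qed
  ultimately have "inner_optimal M w \<and> generated M w y = u" ..
  then show "greedy M y u" unfolding greedy_def by (rule exI[of _ w])
qed

text \<open>The dynamic programming value bounds all randomized policies and a generated policy
  attains it, so the supremum is a maximum.\<close>

lemma Jhat_star_eq: "Jhat_star M s0 y = V_star M 0 s0 y"
proof -
  obtain u where "greedy M y u" using greedy_exists by auto
  then have u: "u \<in> HD M" "conserving M y u" unfolding greedy_iff by auto
  show ?thesis unfolding Jhat_star_def
  proof (rule cSup_eq_maximum)
    show "V_star M 0 s0 y \<in> (\<lambda>u. Jhat M u s0 y) ` HR M"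
      using Jhat_conserving[OF u, of s0] det_policy_HR[OF u(1)] by (metis image_eqI)
  qed (auto intro: Jhat_le_V_star)
qed

lemma Jhat_le_star: "u \<in> HR M \<Longrightarrow> Jhat M u s0 y \<le> Jhat_star M s0 y"
  by (simp add: Jhat_star_eq Jhat_le_V_star)

lemma greedy_optimal: "greedy M y u \<Longrightarrow> pseudo_optimal M s0 y (det_policy u)"
  unfolding greedy_iff pseudo_optimal_def Jhat_star_eq
  using Jhat_conserving det_policy_HR by auto

section \<open>Continuity and limits in the pseudo mean\<close>

lemma continuous_V_rem: "continuous_on UNIV (V_rem M n s)"
proof (induction n arbitrary: s)
  case 0
  then show ?case by (auto intro!: continuous_intros)
next
  case (Suc n)
  have "continuous_on UNIV (\<lambda>y. Q_value M (horizon M - Suc n) (V_rem M n) s y a)" for a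
    unfolding Q_value_def
    by (intro continuous_intros continuous_on_compose2[OF Suc.IH]) auto
  then have "continuous_on UNIV
      (\<lambda>y. Max ((\<lambda>a. Q_value M (horizon M - Suc n) (V_rem M n) s y a) ` adm M s))"
    by (intro continuous_on_Max adm_nonempty) simp_all
  then show ?case unfolding V_rem.simps .
qed

lemma isCont_V_star: "isCont (V_star M t s) y"
  using continuous_V_rem[of "horizon M - t" s] unfolding V_star_def
  by (simp add: continuous_on_eq_continuous_at)

text \<open>There are only finitely many deterministic policies, so one of them is generated
  frequently along \<open>F\<close>. Being generated amounts to conditions free of \<open>y\<close>
  and equations continuous in \<open>y\<close>, and these persist at \<open>c\<close>.\<close>

lemma greedy_limit:
  assumes "F \<noteq> bot" "F \<le> nhds c"
  shows "\<exists>u. greedy M c u \<and> frequently (\<lambda>y. greedy M y u) F"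
proof -
  have "\<exists>u \<in> HD M. greedy M y u" for y
    using greedy_exists[of y] greedy_iff by blast
  then have "frequently (\<lambda>y. \<exists>u \<in> HD M. greedy M y u) F"
    using assms(1) by (simp add: frequently_const)
  then obtain u where u: "u \<in> HD M" "frequently (\<lambda>y. greedy M y u) F"
    using frequently_bex_finite[OF finite_HD] by blast
  \<comment> \<open>This condition does not mention \<open>y\<close>, so one point at which
    \<open>u\<close> is generated suffices.\<close>
  have "reward_markov M u" using frequently_ex[OF u(2)] unfolding greedy_iff by auto
  moreover have "conserving M c u"
    unfolding conserving_def
  proof
    fix h assume h: "h \<in> hists M"
    let ?t = "length (fst h)" and ?s = "snd h" and ?p = "past_reward M (fst h)"
    show "Q_value M ?t (V_star M (Suc ?t)) ?s (c - ?p) (u h) = V_star M ?t ?s (c - ?p)"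
    proof (rule frequently_eq_limit[where F = F and c = c and
          f = "\<lambda>y. Q_value M ?t (V_star M (Suc ?t)) ?s (y - ?p) (u h)" and
          g = "\<lambda>y. V_star M ?t ?s (y - ?p)"])
      show "frequently (\<lambda>y. Q_value M ?t (V_star M (Suc ?t)) ?s (y - ?p) (u h) = V_star M ?t ?s (y - ?p)) F"
        using u(2) by (rule frequently_elim1) (use h in \<open>auto simp: greedy_iff conserving_def\<close>)
      show "isCont (\<lambda>y. Q_value M ?t (V_star M (Suc ?t)) ?s (y - ?p) (u h)) c"
        unfolding Q_value_def
        by (intro continuous_intros isCont_o2[OF _ isCont_V_star])
      show "isCont (\<lambda>y. V_star M ?t ?s (y - ?p)) c"
        by (intro isCont_o2[OF _ isCont_V_star] continuous_intros)
    qed (rule assms(2))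
  qed
  ultimately have "greedy M c u" using u(1) by (simp only: greedy_iff)
  with u(2) show ?thesis by blast
qed

section \<open>Comparison of policies across pseudo means\<close>

lemma Jhat_difference_affine:
  "Jhat M u s0 y - Jhat M v s0 y =
    (J M u s0 - risk M * (mean M u s0)\<^sup>2) - (J M v s0 - risk M * (mean M v s0)\<^sup>2)
    + 2 * risk M * (mean M u s0 - mean M v s0) * y"
  unfolding Jhat_eq_J by (simp add: power2_eq_square algebra_simps)

text \<open>Compared with a policy optimal at \<open>y\<close>, the difference is affine in the
  pseudo mean. It is nonpositive at both ends of the interval and hence at \<open>y\<close>; the
  sign of the slope decides which end is used.\<close>

lemma pseudo_optimal_between:
  assumes "pseudo_optimal M s0 a u" "pseudo_optimal M s0 b u" "y \<in> {a..b}"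
  shows "pseudo_optimal M s0 y u"
proof -
  obtain v where "greedy M y v" using greedy_exists by blast
  then have v: "pseudo_optimal M s0 y (det_policy v)" by (rule greedy_optimal)
  let ?D = "\<lambda>x. Jhat M (det_policy v) s0 x - Jhat M u s0 x"
  let ?d = "2 * risk M * (mean M (det_policy v) s0 - mean M u s0)"
  have D: "?D x \<le> 0" if "pseudo_optimal M s0 x u" for x
    using that v Jhat_le_star[of "det_policy v" s0 x] unfolding pseudo_optimal_def by simp
  have "?D y \<le> 0"
  proof (cases "0 \<le> ?d")
    case True
    then have "?d * y \<le> ?d * b" using assms(3) by (intro mult_left_mono) auto
    then show ?thesis using D[OF assms(2)] unfolding Jhat_difference_affine by linarith
  next
    case False
    then have "?d * y \<le> ?d * a" using assms(3) by (intro mult_left_mono_neg) auto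
    then show ?thesis using D[OF assms(1)] unfolding Jhat_difference_affine by linarith
  qed
  with v assms(1) Jhat_le_star[of u s0 y] show ?thesis unfolding pseudo_optimal_def by simp
qed

text \<open>An affine difference with two distinct zeros has slope zero, and for nonzero risk the
  slope is a nonzero multiple of the difference of the means.\<close>

lemma pseudo_optimal_mean_unique:
  assumes "risk M \<noteq> 0" "a \<noteq> b"
    and "pseudo_optimal M s0 a u" "pseudo_optimal M s0 b u"
    and "pseudo_optimal M s0 a v" "pseudo_optimal M s0 b v"
  shows "mean M u s0 = mean M v s0"
proof -
  have "Jhat M u s0 a - Jhat M v s0 a = 0" "Jhat M u s0 b - Jhat M v s0 b = 0"
    using assms(3-6) unfolding pseudo_optimal_def by simp_all
  then have "2 * risk M * (mean M u s0 - mean M v s0) * a = 2 * risk M * (mean M u s0 - mean M v s0) * b"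
    unfolding Jhat_difference_affine by linarith
  with assms(1,2) show ?thesis by simp
qed

section \<open>Break points and their absence\<close>

lemma J_riskless: "risk M = 0 \<Longrightarrow> J M u s0 = mean M u s0"
  by (simp add: J_def law_mv_def mean_def)

text \<open>Without risk \<open>Jhat\<close> is independent of the pseudo mean, so a policy optimal
  at \<open>y\<close> cannot cease to be optimal to the right of it.\<close>

lemma break_point_risk: "break_point M s0 y \<Longrightarrow> risk M \<noteq> 0"
proof
  assume "break_point M s0 y" and [simp]: "risk M = 0"
  then obtain y1 y2 u where y: "y1 < y" "y < y2" "\<forall>z \<in> {y1..y}. pseudo_optimal M s0 z u"
    "\<forall>z \<in> {y<..y2}. \<not> pseudo_optimal M s0 z u" unfolding break_point_def by blast
  have "pseudo_optimal M s0 y u" "\<not> pseudo_optimal M s0 y2 u" using y by auto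
  then show False unfolding pseudo_optimal_def Jhat_star_def Jhat_eq_J by simp
qed

text \<open>Yields one policy optimal at two distinct points, which is what comparing slopes
  requires.\<close>

lemma greedy_left:
  assumes "y1 < y"
  shows "\<exists>u. \<exists>z \<in> {y1<..<y}. greedy M y u \<and> greedy M z u"
proof -
  obtain u where u: "greedy M y u" "frequently (\<lambda>z. greedy M z u) (at_left y)"
    using greedy_limit[OF trivial_limit_at_left_real at_within_le_nhds] by blast
  have "eventually (\<lambda>z. z \<in> {y1<..<y}) (at_left y)"
    using assms by (rule eventually_at_left_real)
  with u show ?thesis using frequently_ex[OF frequently_eventually_conj] by blast
qed

lemma greedy_right:
  assumes "y < y2"
  shows "\<exists>u. \<exists>z \<in> {y<..<y2}. greedy M y u \<and> greedy M z u"
proof -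
  obtain u where u: "greedy M y u" "frequently (\<lambda>z. greedy M z u) (at_right y)"
    using greedy_limit[OF trivial_limit_at_right_real at_within_le_nhds] by blast
  have "eventually (\<lambda>z. z \<in> {y<..<y2}) (at_right y)"
    using assms by (rule eventually_at_right_real)
  with u show ?thesis using frequently_ex[OF frequently_eventually_conj] by blast
qed

text \<open>The policy \<open>u\<close> from the left shares two points of optimality with the
  breaking policy \<open>b\<close>, hence its mean. If the policy \<open>v\<close> from the right
  had that mean too, then \<open>v\<close> and \<open>b\<close>, both optimal at \<open>y\<close>,
  would have the same \<open>J\<close> and so the same parabola, and \<open>b\<close> would stay
  optimal at \<open>z'\<close> beyond the break.\<close>

lemma break_point_two_means:
  assumes "break_point M s0 y"
  shows "\<exists>u v. greedy M y u \<and> greedy M y v \<and> mean M (det_policy u) s0 \<noteq> mean M (det_policy v) s0"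
proof -
  obtain y1 y2 b where y: "y1 < y" "y < y2" "\<forall>z \<in> {y1..y}. pseudo_optimal M s0 z b"
    "\<forall>z \<in> {y<..y2}. \<not> pseudo_optimal M s0 z b" using assms unfolding break_point_def by blast
  have b: "pseudo_optimal M s0 y b" using y by simp
  obtain u z where u: "greedy M y u" "greedy M z u" "y1 < z" "z < y"
    using greedy_left[OF y(1)] by auto
  obtain v z' where v: "greedy M y v" "greedy M z' v" "y < z'" "z' < y2"
    using greedy_right[OF y(2)] by auto
  have "pseudo_optimal M s0 z b" using y u by simp
  then have mean_u: "mean M (det_policy u) s0 = mean M b s0"
    using u b by (intro pseudo_optimal_mean_unique[OF break_point_risk[OF assms], of z y])
      (auto intro: greedy_optimal)
  have "mean M (det_policy v) s0 \<noteq> mean M b s0"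
  proof
    assume eq: "mean M (det_policy v) s0 = mean M b s0"
    have "J M (det_policy v) s0 = J M b s0"
      using greedy_optimal[OF v(1), of s0] b unfolding pseudo_optimal_def Jhat_eq_J eq by simp
    then have "pseudo_optimal M s0 z' b"
      using greedy_optimal[OF v(2), of s0] b unfolding pseudo_optimal_def Jhat_eq_J eq by simp
    with y v show False by simp
  qed
  with u v mean_u show ?thesis by metis
qed

text \<open>A policy generated at \<open>y\<close> and at a point to its left is optimal in between.
  Were it optimal nowhere just to the right, \<open>y\<close> would be a break point; so it is
  optimal at some \<open>y2\<close> and therefore on all of \<open>{y1..y2}\<close>.\<close>

lemma no_break_point_neighbourhood:
  assumes "y \<in> Y_range M" "\<not> break_point M s0 y"
  shows "\<exists>b. \<exists>e>0. \<forall>z \<in> {y - e..y + e}. pseudo_optimal M s0 z b"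
proof -
  obtain u y1 where u: "greedy M y u" "greedy M y1 u" "y1 < y"
    using greedy_left[of "y - 1" y] by auto
  let ?b = "det_policy u"
  have left: "\<forall>z \<in> {y1..y}. pseudo_optimal M s0 z ?b"
    using pseudo_optimal_between greedy_optimal u by blast
  then obtain y2 where y2: "y < y2" "pseudo_optimal M s0 y2 ?b"
    using assms u(3) unfolding break_point_def
    by (metis greaterThanAtMost_iff less_add_one)
  show ?thesis
  proof (intro exI conjI)
    show "0 < min (y - y1) (y2 - y)" using u y2 by simp
    have "{y - min (y - y1) (y2 - y)..y + min (y - y1) (y2 - y)} \<subseteq> {y1..y2}"
      by (auto simp: min_def split: if_splits)
    then show "\<forall>z \<in> {y - min (y - y1) (y2 - y)..y + min (y - y1) (y2 - y)}. pseudo_optimal M s0 z ?b"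
      using pseudo_optimal_between[OF greedy_optimal[OF u(2)] y2(2)] by blast
  qed
qed

text \<open>The difference from \<open>b\<close> is affine, nonpositive around \<open>y\<close> and
  zero at \<open>y\<close>, so its slope vanishes. For zero risk the slope carries no information,
  but then \<open>J\<close> is itself the mean.\<close>

lemma neighbourhood_mean_unique:
  assumes "0 < e" "\<forall>z \<in> {y - e..y + e}. pseudo_optimal M s0 z b" "pseudo_optimal M s0 y v"
  shows "mean M v s0 = mean M b s0"
proof (cases "risk M = 0")
  case True
  have "pseudo_optimal M s0 y b" using assms by simp
  with assms(3) True show ?thesis
    unfolding pseudo_optimal_def Jhat_eq_J by (simp add: J_riskless)
next
  case False
  define d where "d = 2 * risk M * (mean M v s0 - mean M b s0)"
  have D: "Jhat M v s0 z - Jhat M b s0 z \<le> 0" if "z \<in> {y - e..y + e}" for z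
    using that assms Jhat_le_star[of v s0 z] unfolding pseudo_optimal_def by auto
  have "pseudo_optimal M s0 y b" using assms by simp
  then have D0: "Jhat M v s0 y - Jhat M b s0 y = 0"
    using assms(3) unfolding pseudo_optimal_def by simp
  have "d * (y + e) \<le> d * y" "d * (y - e) \<le> d * y"
    using D[of "y + e"] D[of "y - e"] D0 assms(1)
    unfolding Jhat_difference_affine d_def[symmetric] by auto
  then have "d = 0"
    using assms(1) by (auto simp: mult_le_cancel_left)
  with False show ?thesis unfolding d_def by simp
qed

section \<open>Range of the means and policy improvement\<close>

lemma mean_Y_range:
  assumes "u \<in> HR M"
  shows "mean M u s0 \<in> Y_range M"
proof -
  have "reward_values M \<subseteq> (\<lambda>(t, s, a). rew M t s a) ` ({..<horizon M} \<times> UNIV \<times> UNIV)"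
    by (auto simp: reward_values_def image_def)
  then have fin: "finite (reward_values M)" by (rule finite_subset) simp
  have bounds: "x \<in> Y_range M" if x: "x \<in> set_pmf (reward_pmf M u s0)" for x
  proof -
    obtain h where h: "h \<in> set_pmf (history_pmf M u s0 (horizon M))" "x = past_reward M (fst h)"
      using x unfolding reward_pmf_def by auto
    have len: "length (fst h) = horizon M" and adm: "\<forall>(x, a) \<in> set (fst h). a \<in> adm M x"
      using history_pmf_support[OF assms order_refl h(1)] by auto
    have "rew M i (fst (fst h ! i)) (snd (fst h ! i)) \<in> reward_values M" if "i < horizon M" for i
      using adm nth_mem[of i "fst h"] that len unfolding reward_values_def by fastforce
    then have le: "Min (reward_values M) \<le> rew M i (fst (fst h ! i)) (snd (fst h ! i))"
      "rew M i (fst (fst h ! i)) (snd (fst h ! i)) \<le> Max (reward_values M)"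
      if "i \<in> {..<horizon M}" for i
      using fin that by (auto intro: Min_le Max_ge)
    have "real (card {..<horizon M}) * Min (reward_values M)
        \<le> (\<Sum>i<horizon M. rew M i (fst (fst h ! i)) (snd (fst h ! i)))"
      by (rule sum_bounded_below) (rule le(1))
    moreover have "(\<Sum>i<horizon M. rew M i (fst (fst h ! i)) (snd (fst h ! i)))
        \<le> real (card {..<horizon M}) * Max (reward_values M)"
      by (rule sum_bounded_above) (rule le(2))
    ultimately show ?thesis
      unfolding h(2) past_reward_def len Y_range_def by simp
  qed
  have "measure_pmf.expectation (reward_pmf M u s0) (\<lambda>x. real (horizon M) * Min (reward_values M))
      \<le> mean M u s0"
    "mean M u s0 \<le>
      measure_pmf.expectation (reward_pmf M u s0) (\<lambda>x. real (horizon M) * Max (reward_values M))"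
    unfolding mean_def using bounds unfolding Y_range_def
    by (intro expectation_mono_finite finite_reward_pmf, simp)+
  then show ?thesis unfolding Y_range_def by simp
qed

text \<open>At its own mean \<open>u\<close> pays no penalty, while \<open>u'\<close> still pays for
  the distance of its mean from that of \<open>u\<close>. Moving the pseudo mean to that of
  \<open>u'\<close> recovers this amount.\<close>

lemma J_greedy_ge:
  assumes "u \<in> HR M" "greedy M (mean M u s0) u'"
  shows "J M u s0 + risk M * (mean M (det_policy u') s0 - mean M u s0)\<^sup>2 \<le> J M (det_policy u') s0"
  using Jhat_le_star[OF assms(1), of s0 "mean M u s0"] greedy_optimal[OF assms(2), of s0]
  unfolding pseudo_optimal_def Jhat_eq_J by simp

text \<open>For one initial state, every randomized policy is matched or beaten by a deterministic
  one generated at its mean, and of these there are finitely many. The best policies for the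
  separate initial states are then glued together.\<close>

lemma HD_optimal_exists: "\<exists>w \<in> HD M. \<forall>s0. J M (det_policy w) s0 = J_star M s0"
proof -
  have max: "\<exists>w. w \<in> HD M \<and> (\<forall>u \<in> HR M. J M u s0 \<le> J M (det_policy w) s0)" for s0
  proof -
    obtain g0 where "greedy M 0 g0" using greedy_exists by blast
    then have "HD M \<noteq> {}" unfolding greedy_iff by blast
    define f where "f w = J M (det_policy w) s0" for w
    have fin: "finite (f ` HD M)" by (intro finite_imageI finite_HD)
    then have "Max (f ` HD M) \<in> f ` HD M" using \<open>HD M \<noteq> {}\<close> by (intro Max_in) simp_all
    then obtain w where w: "w \<in> HD M" "Max (f ` HD M) = f w" by blast
    have "J M u s0 \<le> f w" if u: "u \<in> HR M" for u
    proof -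
      obtain g where g: "greedy M (mean M u s0) g" using greedy_exists by blast
      then have "g \<in> HD M" unfolding greedy_iff by blast
      then have "f g \<le> f w" using Max_ge[OF fin imageI] w(2) by metis
      moreover have "0 \<le> risk M * (mean M (det_policy g) s0 - mean M u s0)\<^sup>2"
        using risk_nonneg by simp
      ultimately show ?thesis using J_greedy_ge[OF u g] unfolding f_def by linarith
    qed
    with w(1) show ?thesis unfolding f_def by blast
  qed
  have sup: "J_star M s0 = J M (det_policy w) s0"
    if "w \<in> HD M" "\<forall>u \<in> HR M. J M u s0 \<le> J M (det_policy w) s0" for w s0
  proof -
    define f where "f u = J M u s0" for u
    have "f (det_policy w) \<in> f ` HR M" by (rule imageI[OF det_policy_HR[OF that(1)]])
    moreover have "x \<le> f (det_policy w)" if "x \<in> f ` HR M" for x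
      using that \<open>\<forall>u \<in> HR M. J M u s0 \<le> J M (det_policy w) s0\<close> unfolding f_def by blast
    ultimately have "Sup (f ` HR M) = f (det_policy w)" by (rule cSup_eq_maximum)
    then show ?thesis unfolding J_star_def f_def .
  qed
  have "\<forall>s0. \<exists>w. w \<in> HD M \<and> (\<forall>u \<in> HR M. J M u s0 \<le> J M (det_policy w) s0)"
    using max by (rule allI)
  from choice[OF this] obtain v where
    v: "\<forall>s0. v s0 \<in> HD M \<and> (\<forall>u \<in> HR M. J M u s0 \<le> J M (det_policy (v s0)) s0)" by (rule exE)
  have v_HD: "v s0 \<in> HD M" for s0 using v by blast
  have "J M (det_policy (assemble M v)) s0 = J_star M s0" for s0
  proof -
    have "J_star M s0 = J M (det_policy (v s0)) s0" using v by (intro sup) blast+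
    then show ?thesis unfolding J_def reward_pmf_assemble[of v, OF v_HD] by (rule sym)
  qed
  with assemble_HD[of v, OF v_HD] show ?thesis by blast
qed

section \<open>Invariant and termination of the algorithm\<close>

lemma coherent_step: "alg_step M s0 c c' \<Longrightarrow> coherent M s0 c'"
  by (induction rule: alg_step.induct) (auto simp: coherent_def generated_HD)

lemma coherent_reachable:
  assumes "(alg_step M s0)\<^sup>*\<^sup>* (alg_start u0) c" "u0 \<in> HD M"
  shows "coherent M s0 c"
  using assms(1)
proof cases
  case rtrancl_refl
  with assms(2) show ?thesis by (auto simp: alg_start_def coherent_def)
next
  case (rtrancl_into_rtrancl b)
  then show ?thesis by (blast intro: coherent_step)
qed

lemma potential_less:
  assumes "u' \<in> HD M"
    and "J M (det_policy u) s0 < J M (det_policy u') s0 \<or>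
      J M (det_policy u) s0 = J M (det_policy u') s0 \<and> phase M s0 (p', w', u') < phase M s0 (p, w, u)"
  shows "potential M s0 (p', w', u') < potential M s0 (p, w, u)"
  using assms(2)
proof
  let ?B = "\<lambda>u. {v \<in> HD M. J M (det_policy u) s0 < J M (det_policy v) s0}"
  assume less: "J M (det_policy u) s0 < J M (det_policy u') s0"
  \<comment> \<open>The inclusion is strict because \<open>u'\<close> is better than
    \<open>u\<close> but not than itself.\<close>
  then have "?B u' \<subset> ?B u" using assms(1) by force
  then have "card (?B u') < card (?B u)" by (rule psubset_card_mono[rotated]) (simp add: finite_HD)
  moreover have "phase M s0 (p', w', u') \<le> 2" by (simp add: phase_def)
  ultimately show ?thesis unfolding potential_def by simp
next
  assume "J M (det_policy u) s0 = J M (det_policy u') s0 \<and> phase M s0 (p', w', u') < phase M s0 (p, w, u)"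
  then show ?thesis unfolding potential_def by simp
qed

text \<open>If the current policy is generated at its mean, it is kept and the phase falls from 1 to
  0. Otherwise the phase is 2, and either \<open>J\<close> rises or the mean is unchanged, in which
  case the new policy is generated at its own mean and the phase falls. An escape raises
  \<open>J\<close> by its very condition.\<close>

lemma potential_step:
  assumes "alg_step M s0 c c'" "coherent M s0 c"
  shows "potential M s0 c' < potential M s0 c"
  using assms
proof cases
  case (improve p u y w' u' w)
  have u: "u \<in> HD M" using assms(2) improve by (simp add: coherent_def)
  have u': "u' \<in> HD M" using improve by (simp add: generated_HD)
  have gr: "greedy M (mean M (det_policy u) s0) u'" using improve unfolding greedy_def by blast
  have ge: "J M (det_policy u) s0 + risk M * (mean M (det_policy u') s0 - mean M (det_policy u) s0)\<^sup>2
      \<le> J M (det_policy u') s0"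
    using J_greedy_ge[OF det_policy_HR[OF u] gr] .
  show ?thesis unfolding improve(1,2)
  proof (rule potential_less[OF u'], cases "greedy M (mean M (det_policy u) s0) u")
    case True
    then have "u' = u" using improve unfolding greedy_def by blast
    then show "J M (det_policy u) s0 < J M (det_policy u') s0 \<or>
      J M (det_policy u) s0 = J M (det_policy u') s0 \<and>
      phase M s0 (Some u, Some w', u') < phase M s0 (p, w, u)"
      using improve(3) by (simp add: phase_def)
  next
    case False
    have "0 \<le> risk M * (mean M (det_policy u') s0 - mean M (det_policy u) s0)\<^sup>2"
      using risk_nonneg by simp
    then have "J M (det_policy u) s0 < J M (det_policy u') s0 \<or>
        J M (det_policy u) s0 = J M (det_policy u') s0 \<and>
        risk M * (mean M (det_policy u') s0 - mean M (det_policy u) s0)\<^sup>2 = 0"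
      using ge by linarith
    \<comment> \<open>A vanishing squared term forces equal means for nonzero risk; for zero risk
      equality of \<open>J\<close> does.\<close>
    then have "J M (det_policy u) s0 < J M (det_policy u') s0 \<or>
        J M (det_policy u) s0 = J M (det_policy u') s0 \<and>
        mean M (det_policy u') s0 = mean M (det_policy u) s0"
      using J_riskless by (cases "risk M = 0") auto
    then show "J M (det_policy u) s0 < J M (det_policy u') s0 \<or>
      J M (det_policy u) s0 = J M (det_policy u') s0 \<and>
      phase M s0 (Some u, Some w', u') < phase M s0 (p, w, u)"
      using gr False improve(3) by (auto simp: phase_def)
  qed
next
  case (escape y u w' w u')
  then have "J M (det_policy u) s0 < J M (det_policy u') s0" by (simp add: Jhat_eq_J)
  moreover have "u' \<in> HD M" using escape by (simp add: generated_HD)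
  ultimately show ?thesis unfolding escape(1,2) by (intro potential_less) auto
qed

text \<open>Two policies generated at \<open>y\<close> have different means, so one of the means is
  not \<open>y\<close>. Policy improvement towards that policy is then strict, because the risk is
  positive at a break point.\<close>

lemma escape_possible:
  assumes "coherent M s0 (Some u, w, u)" "break_point M s0 (mean M (det_policy u) s0)"
  shows "\<exists>c'. alg_step M s0 (Some u, w, u) c'"
proof -
  define y where "y = mean M (det_policy u) s0"
  have bp: "break_point M s0 y" using assms(2) unfolding y_def .
  have "u \<in> HD M \<and> (\<exists>w'. w = Some w' \<and> inner_optimal M w' \<and> u = generated M w' y)"
    using assms(1) unfolding coherent_def prod.case y_def by blast
  then obtain w0 where u: "u \<in> HD M" and w0: "w = Some w0" "u = generated M w0 y" by blast
  obtain u1 u2 where "greedy M y u1" "greedy M y u2"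
      "mean M (det_policy u1) s0 \<noteq> mean M (det_policy u2) s0"
    using break_point_two_means[OF bp] by blast
  then obtain u' where u': "greedy M y u'" "mean M (det_policy u') s0 \<noteq> y"
    by (cases "mean M (det_policy u1) s0 = y") auto
  then obtain w' where w': "inner_optimal M w'" "generated M w' y = u'"
    unfolding greedy_def by blast
  have "0 < risk M * (mean M (det_policy u') s0 - y)\<^sup>2"
    using break_point_risk[OF bp] risk_nonneg u'(2) by simp
  then have less: "J M (det_policy u) s0 < J M (det_policy u') s0"
    using J_greedy_ge[OF det_policy_HR[OF u], of s0 u'] u'(1) unfolding y_def by linarith
  have "alg_step M s0 (Some u, Some w0, u) (Some u, Some w', u')"
  proof (rule alg_step.escape[OF y_def bp w'(1) _ w'(2)[symmetric]])
    \<comment> \<open>At the same pseudo mean \<open>w0\<close> generates \<open>u\<close>, whose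
      \<open>J\<close> is strictly smaller.\<close>
    show "w' \<noteq> w0" using less w0(2) w'(2) by (metis less_irrefl)
    show "Jhat M (det_policy u) s0 (mean M (det_policy u) s0) <
      Jhat M (det_policy u') s0 (mean M (det_policy u') s0)"
      using less by (simp add: Jhat_eq_J)
  qed
  then show ?thesis unfolding w0(1) by (rule exI)
qed

lemma algorithm_terminates:
  assumes "u0 \<in> HD M"
  shows "alg_terminates M s0 u0"
  unfolding alg_terminates_def
proof (intro conjI notI allI impI)
  assume "\<exists>c. c 0 = alg_start u0 \<and> (\<forall>k::nat. alg_step M s0 (c k) (c (Suc k)))"
  then obtain c where c: "c 0 = alg_start u0" "\<And>k::nat. alg_step M s0 (c k) (c (Suc k))" by blast
  have "(alg_step M s0)\<^sup>*\<^sup>* (alg_start u0) (c k)" for k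
  proof (induction k)
    case (Suc k)
    then show ?case using c(2)[of k] by (rule rtranclp.rtrancl_into_rtrancl)
  qed (simp add: c(1))
  then have coh: "coherent M s0 (c k)" for k using assms by (rule coherent_reachable)
  \<comment> \<open>Each step costs at least one unit, so no run outlasts its initial
    potential.\<close>
  have "potential M s0 (c k) + k \<le> potential M s0 (c 0)" for k
  proof (induction k)
    case (Suc k)
    with potential_step[OF c(2) coh, of k] show ?case by simp
  qed simp
  from this[of "Suc (potential M s0 (c 0))"] show False by simp
next
  fix c assume "(alg_step M s0)\<^sup>*\<^sup>* (alg_start u0) c"
  then have coh: "coherent M s0 c" using assms by (rule coherent_reachable)
  obtain p w u where c: "c = (p, w, u)" by (cases c)
  let ?y = "mean M (det_policy u) s0"
  show "alg_halted M s0 c \<or> (\<exists>c'. alg_step M s0 c c')"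
  proof (cases "p = Some u")
    case True
    show ?thesis
    proof (cases "break_point M s0 ?y")
      case bp: True
      have "coherent M s0 (Some u, w, u)" using coh unfolding c True .
      from escape_possible[OF this bp] show ?thesis unfolding c True by (rule disjI2)
    next
      case False
      with True show ?thesis unfolding c alg_halted_def by simp
    qed
  next
    case False
    \<comment> \<open>The current policy has to be kept if it can be generated; \<open>w'\<close> is
      then chosen to generate it.\<close>
    obtain w' where w': "inner_optimal M w'" "greedy M ?y u \<longrightarrow> generated M w' ?y = u"
      using inner_optimal_exists unfolding greedy_def by (cases "greedy M ?y u") (auto simp: greedy_def)
    have "alg_step M s0 (p, w, u) (Some u, Some w', generated M w' ?y)"
      using w'(2) unfolding greedy_def by (intro alg_step.improve[OF False refl w'(1) refl])
    then show ?thesis unfolding c by blast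
  qed
qed

text \<open>On halting, the previous policy, whose mean was used to generate \<open>u\<close>, is
  \<open>u\<close> itself.\<close>

lemma returned_fixed_point:
  assumes "alg_returns M s0 u0 u y" "u0 \<in> HD M"
  shows "u \<in> HD M" "y = mean M (det_policy u) s0" "greedy M y u" "\<not> break_point M s0 y"
proof -
  obtain p w where r: "(alg_step M s0)\<^sup>*\<^sup>* (alg_start u0) (p, w, u)" "alg_halted M s0 (p, w, u)"
    and y: "y = mean M (det_policy u) s0" using assms(1) unfolding alg_returns_def by blast
  have p: "p = Some u" and nb: "\<not> break_point M s0 y" using r(2) y unfolding alg_halted_def by auto
  have "coherent M s0 (p, w, u)" using coherent_reachable[OF r(1) assms(2)] .
  then show "u \<in> HD M" "greedy M y u" using p y unfolding coherent_def greedy_def by auto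
  show "y = mean M (det_policy u) s0" by fact
  show "\<not> break_point M s0 y" by fact
qed

text \<open>\<open>Jhat\<close> is linear in the law of the reward, so it mixes linearly; adding the
  penalty at the mean of the mixture returns \<open>J\<close>. The reference point \<open>y\<close>
  is free and is later set to the mean of the unmixed policy.\<close>

lemma J_mixed_eq:
  assumes "0 \<le> d" "d \<le> 1"
  shows "J_mixed M d u u' s0 =
    (1 - d) * Jhat M (det_policy u) s0 y + d * Jhat M (det_policy u') s0 y +
    risk M * ((1 - d) * mean M (det_policy u) s0 + d * mean M (det_policy u') s0 - y)\<^sup>2"
proof -
  define p where "p = bind_pmf (bernoulli_pmf d) (\<lambda>b. reward_pmf M (det_policy (if b then u' else u)) s0)"
  have E: "measure_pmf.expectation p f =
      (1 - d) * measure_pmf.expectation (reward_pmf M (det_policy u) s0) f +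
      d * measure_pmf.expectation (reward_pmf M (det_policy u') s0) f" for f :: "real \<Rightarrow> real"
    unfolding p_def using assms by (subst expectation_bind_finite) (auto simp: finite_reward_pmf)
  have "finite (set_pmf p)" unfolding p_def by (auto simp: finite_reward_pmf)
  from expectation_penalty[OF this, of "risk M" y] show ?thesis
    unfolding J_mixed_def p_def[symmetric] Jhat_def mean_def E by linarith
qed

section \<open>Policies optimal at their own mean, away from break points\<close>

context
  fixes u :: "('s, 'a) dpolicy"
  assumes HD: "u \<in> HD M"
    and optimal: "\<And>s0. pseudo_optimal M s0 (mean M (det_policy u) s0) (det_policy u)"
    and no_break: "\<And>s0. \<not> break_point M s0 (mean M (det_policy u) s0)"
begin

text \<open>The policy \<open>b\<close> optimal on both sides may differ from \<open>u\<close>, but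
  both are optimal at the mean of \<open>u\<close>, and this forces equal means.\<close>

lemma stationary_neighbourhood:
  "\<exists>b. \<exists>e>0. mean M b s0 = mean M (det_policy u) s0 \<and>
    (\<forall>z \<in> {mean M (det_policy u) s0 - e..mean M (det_policy u) s0 + e}. pseudo_optimal M s0 z b)"
proof -
  obtain b e where b: "e > 0"
    "\<forall>z \<in> {mean M (det_policy u) s0 - e..mean M (det_policy u) s0 + e}. pseudo_optimal M s0 z b"
    \<comment> \<open>Break points lie in \<open>Y_range M\<close> by definition, so the mean has to
      be placed there first.\<close>
    using no_break_point_neighbourhood[OF mean_Y_range[OF det_policy_HR[OF HD]] no_break] by blast
  with neighbourhood_mean_unique[OF b optimal] show ?thesis by metis
qed

lemma stationary_mean_unique:
  assumes "pseudo_optimal M s0 (mean M (det_policy u) s0) v"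
  shows "mean M v s0 = mean M (det_policy u) s0"
proof -
  obtain b e where b: "e > 0" "mean M b s0 = mean M (det_policy u) s0"
    "\<forall>z \<in> {mean M (det_policy u) s0 - e..mean M (det_policy u) s0 + e}. pseudo_optimal M s0 z b"
    using stationary_neighbourhood[of s0] by blast
  from neighbourhood_mean_unique[OF b(1,3) assms] b(2) show ?thesis by simp
qed

lemma stationary_local_max: "local_max_on (Y_range M) (Jhat_star M s0) (mean M (det_policy u) s0)"
proof -
  let ?y = "mean M (det_policy u) s0"
  obtain b e where b: "e > 0" "mean M b s0 = ?y" "\<forall>z \<in> {?y - e..?y + e}. pseudo_optimal M s0 z b"
    using stationary_neighbourhood[of s0] by blast
  have "Jhat_star M s0 z \<le> Jhat_star M s0 ?y" if "\<bar>z - ?y\<bar> < e" for z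
  proof -
    have "z \<in> {?y - e..?y + e}" "?y \<in> {?y - e..?y + e}" using b(1) that by (simp_all add: abs_less_iff)
    then have "pseudo_optimal M s0 z b" "pseudo_optimal M s0 ?y b" using b(3) by blast+
    \<comment> \<open>Near \<open>?y\<close> the optimal value is the parabola of \<open>b\<close>,
      whose peak is at the mean of \<open>b\<close>, that is at \<open>?y\<close>.\<close>
    then have "Jhat_star M s0 z = J M b s0 - risk M * (?y - z)\<^sup>2" "Jhat_star M s0 ?y = J M b s0"
      unfolding pseudo_optimal_def Jhat_eq_J b(2) by auto
    then show ?thesis using risk_nonneg by simp
  qed
  with b(1) mean_Y_range[OF det_policy_HR[OF HD], of s0] show ?thesis
    unfolding local_max_on_def by blast
qed

text \<open>If the optimal policy \<open>w\<close> is pruned, it ties with \<open>u\<close> for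
  every initial state. A tie makes it optimal at the pseudo mean, so its mean and then its
  \<open>J\<close> agree with those of \<open>u\<close>, and \<open>u\<close> is itself
  optimal.\<close>

lemma stationary_valid_pruned:
  "valid_pruned M (U_valid M u (\<lambda>s0. mean M (det_policy u) s0))"
proof -
  let ?U = "U_valid M u (\<lambda>s0. mean M (det_policy u) s0)"
  obtain w where w: "w \<in> HD M" "\<And>s0. J M (det_policy w) s0 = J_star M s0"
    using HD_optimal_exists by blast
  have "\<exists>v \<in> ?U. \<forall>s0. J M (det_policy v) s0 = J_star M s0"
  proof (cases "w \<in> ?U")
    case True
    with w show ?thesis by blast
  next
    case False
    have "J M (det_policy u) s0 = J M (det_policy w) s0" for s0
    proof -
      let ?y = "mean M (det_policy u) s0"
      have eq: "Jhat M (det_policy w) s0 ?y = Jhat M (det_policy u) s0 ?y"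
        using False w(1) unfolding U_valid_def by blast
      then have "pseudo_optimal M s0 ?y (det_policy w)"
        using optimal[of s0] det_policy_HR[OF w(1)] unfolding pseudo_optimal_def by simp
      then have "mean M (det_policy w) s0 = ?y" by (rule stationary_mean_unique)
      with eq show ?thesis unfolding Jhat_eq_J by simp
    qed
    with w(2) have "\<forall>s0. J M (det_policy u) s0 = J_star M s0" by simp
    moreover have "u \<in> ?U" unfolding U_valid_def by blast
    ultimately show ?thesis by blast
  qed
  moreover have "?U \<subseteq> HD M" using HD unfolding U_valid_def by blast
  ultimately show ?thesis unfolding valid_pruned_def by blast
qed

lemma stationary_strictly_local_opt:
  "strictly_local_opt M (U_valid M u (\<lambda>s0. mean M (det_policy u) s0)) u"
proof -
  let ?m = "\<lambda>v. mean M (det_policy v)" and ?J = "\<lambda>s0. J M (det_policy u) s0"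
  let ?U = "U_valid M u (\<lambda>s0. mean M (det_policy u) s0)"
  \<comment> \<open>The loss of \<open>v\<close> against \<open>u\<close> at the pseudo mean of
    \<open>u\<close>.\<close>
  define gap where "gap v s0 = ?J s0 - Jhat M (det_policy v) s0 (?m u s0)" for v s0
  have J_eq: "Jhat M (det_policy u) s0 (?m u s0) = ?J s0" for s0 by (simp add: Jhat_eq_J)
  have gap_nonneg: "0 \<le> gap v s0" if "v \<in> HD M" for v s0
    using Jhat_le_star[OF det_policy_HR[OF that]] optimal[of s0]
    unfolding gap_def pseudo_optimal_def J_eq by simp
  \<comment> \<open>With the mean of \<open>u\<close> as reference point, the mean of the mixture is
    off by \<open>d\<close> times the difference of the means, so the penalty term is of second
    order in \<open>d\<close>.\<close>
  have mixed: "J_mixed M d u v s0 = ?J s0 + d * (d * (risk M * (?m v s0 - ?m u s0)\<^sup>2) - gap v s0)"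
    if "0 < d" "d < 1" for d v s0
    unfolding gap_def using that
    by (simp add: J_mixed_eq[where y = "?m u s0"] J_eq power2_eq_square algebra_simps)
  have zero: "?m v s0 = ?m u s0" if "v \<in> HD M" "gap v s0 = 0" for v s0
  proof (rule stationary_mean_unique)
    show "pseudo_optimal M s0 (?m u s0) (det_policy v)"
      using that optimal[of s0] det_policy_HR[OF that(1)] unfolding gap_def pseudo_optimal_def J_eq by simp
  qed
  have "eventually (\<lambda>d. gap v s0 = 0 \<or> d * (risk M * (?m v s0 - ?m u s0)\<^sup>2) < gap v s0) (at_right 0)"
    if "v \<in> HD M" for v s0
  proof (cases "gap v s0 = 0")
    case False
    then have "0 < gap v s0" using gap_nonneg[OF that, of s0] by linarith
    moreover have "((\<lambda>d. d * (risk M * (?m v s0 - ?m u s0)\<^sup>2)) \<longlongrightarrow> 0 * (risk M * (?m v s0 - ?m u s0)\<^sup>2)) (at_right 0)"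
      by (intro tendsto_intros)
    ultimately have "eventually (\<lambda>d. d * (risk M * (?m v s0 - ?m u s0)\<^sup>2) < gap v s0) (at_right 0)"
      by (intro order_tendstoD(2)) auto
    then show ?thesis by (rule eventually_mono) simp
  qed simp
  \<comment> \<open>There are finitely many policies and initial states, so a common radius
    exists.\<close>
  then have "eventually (\<lambda>d. \<forall>v \<in> HD M. \<forall>s0 \<in> UNIV.
      gap v s0 = 0 \<or> d * (risk M * (?m v s0 - ?m u s0)\<^sup>2) < gap v s0) (at_right 0)"
    by (intro eventually_ball_finite finite_HD finite ballI) auto
  then obtain e where e: "0 < e" "\<And>d v s0. 0 < d \<Longrightarrow> d < e \<Longrightarrow> v \<in> HD M \<Longrightarrow>
      gap v s0 = 0 \<or> d * (risk M * (?m v s0 - ?m u s0)\<^sup>2) < gap v s0"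
    unfolding eventually_at_right_field by blast
  have strict: "J_mixed M d u v s0 < ?J s0"
    if "v \<in> HD M" "d \<in> {0<..<min e 1}" "gap v s0 \<noteq> 0" for d v s0
  proof -
    have "d * (risk M * (?m v s0 - ?m u s0)\<^sup>2) - gap v s0 < 0" using e(2)[of d v s0] that by auto
    then have "d * (d * (risk M * (?m v s0 - ?m u s0)\<^sup>2) - gap v s0) < 0"
      using that by (intro mult_pos_neg) auto
    then show ?thesis using that mixed[of d v s0] by auto
  qed
  have weak: "J_mixed M d u v s0 \<le> ?J s0" if "v \<in> HD M" "d \<in> {0<..<min e 1}" for d v s0
  proof (cases "gap v s0 = 0")
    case True
    \<comment> \<open>With no gap the means agree, and mixing leaves \<open>J\<close>
      unchanged.\<close>
    then show ?thesis using zero[OF that(1) True] that mixed[of d v s0] by simp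
  next
    case False
    then show ?thesis using strict[OF that] by (simp add: less_imp_le)
  qed
  have U: "?U \<subseteq> HD M" "u \<in> ?U" using HD unfolding U_valid_def by auto
  have "\<exists>s0. \<forall>d \<in> {0<..<min e 1}. J_mixed M d u v s0 < ?J s0" if v: "v \<in> ?U - {u}" for v
  proof -
    \<comment> \<open>A policy that survives the pruning differs from \<open>u\<close> at some
      initial state; its gap there is nonzero, hence strictness.\<close>
    obtain s0 where "Jhat M (det_policy v) s0 (?m u s0) \<noteq> Jhat M (det_policy u) s0 (?m u s0)"
      using v unfolding U_valid_def by blast
    then have "gap v s0 \<noteq> 0" unfolding gap_def J_eq by simp
    then show ?thesis using strict v U(1) by blast
  qed
  moreover have "local_opt_radius M ?U u (min e 1)"
    unfolding local_opt_radius_def using e(1) weak U(1) by (auto simp: subset_iff)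
  ultimately show ?thesis unfolding strictly_local_opt_def using U(2) by blast
qed

end

end

section \<open>Combination of the runs for all initial states\<close>

theorem theorem6:
  fixes M :: "('s::finite, 'a::finite) mdp"
  assumes "mv_mdp M"
  shows "(\<forall>s0. \<forall>u0 \<in> HD M. alg_terminates M s0 u0) \<and>
    (\<forall>u0 v ystar ustar.
      (\<forall>s0. u0 s0 \<in> HD M) \<longrightarrow>
      (\<forall>s0. alg_returns M s0 (u0 s0) (v s0) (ystar s0)) \<longrightarrow>
      ustar = assemble M v \<longrightarrow>
        (\<forall>s0. ystar s0 = mean M (det_policy ustar) s0 \<and>
              is_arg_max (\<lambda>u. Jhat M (det_policy u) s0 (ystar s0)) (\<lambda>u. u \<in> HD M) ustar) \<and>
        valid_pruned M (U_valid M ustar ystar) \<and>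
        strictly_local_opt M (U_valid M ustar ystar) ustar \<and>
        (\<forall>s0. local_max_on (Y_range M) (Jhat_star M s0) (ystar s0)))"
proof (rule conjI)
  show "\<forall>s0. \<forall>u0 \<in> HD M. alg_terminates M s0 u0"
    using algorithm_terminates[OF assms] by blast
next
  show "\<forall>u0 v ystar ustar.
      (\<forall>s0. u0 s0 \<in> HD M) \<longrightarrow>
      (\<forall>s0. alg_returns M s0 (u0 s0) (v s0) (ystar s0)) \<longrightarrow>
      ustar = assemble M v \<longrightarrow>
        (\<forall>s0. ystar s0 = mean M (det_policy ustar) s0 \<and>
              is_arg_max (\<lambda>u. Jhat M (det_policy u) s0 (ystar s0)) (\<lambda>u. u \<in> HD M) ustar) \<and>
        valid_pruned M (U_valid M ustar ystar) \<and>
        strictly_local_opt M (U_valid M ustar ystar) ustar \<and>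
        (\<forall>s0. local_max_on (Y_range M) (Jhat_star M s0) (ystar s0))"
  proof (intro allI impI)
    fix u0 v :: "'s \<Rightarrow> ('s, 'a) dpolicy" and ystar :: "'s \<Rightarrow> real" and ustar :: "('s, 'a) dpolicy"
    assume u0: "\<forall>s0. u0 s0 \<in> HD M"
      and ret: "\<forall>s0. alg_returns M s0 (u0 s0) (v s0) (ystar s0)"
      and ustar: "ustar = assemble M v"
    note fp = returned_fixed_point[OF assms ret[rule_format] u0[rule_format]]
    \<comment> \<open>From \<open>s0\<close> the assembled policy has the reward law of the run for
      \<open>s0\<close>; means and \<open>Jhat\<close> depend on this law alone, so the fixed points
      of the runs carry over.\<close>
    have law: "reward_pmf M (det_policy ustar) s0 = reward_pmf M (det_policy (v s0)) s0" for s0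
      unfolding ustar by (rule reward_pmf_assemble) (rule fp(1))
    have HD: "ustar \<in> HD M" unfolding ustar by (rule assemble_HD) (rule fp(1))
    have y: "ystar s0 = mean M (det_policy ustar) s0" for s0
      using fp(2)[of s0] unfolding mean_def law .
    then have ystar: "ystar = (\<lambda>s0. mean M (det_policy ustar) s0)" by blast
    have opt: "pseudo_optimal M s0 (mean M (det_policy ustar) s0) (det_policy ustar)" for s0
      using greedy_optimal[OF assms fp(3), of s0 s0] det_policy_HR[OF HD]
      unfolding y[symmetric] pseudo_optimal_def Jhat_def law by blast
    have nb: "\<not> break_point M s0 (mean M (det_policy ustar) s0)" for s0
      using fp(4)[of s0] unfolding y .
    have "is_arg_max (\<lambda>u. Jhat M (det_policy u) s0 (ystar s0)) (\<lambda>u. u \<in> HD M) ustar" for s0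
      using HD opt[of s0] Jhat_le_star[OF assms det_policy_HR, of _ s0 "ystar s0"]
      unfolding is_arg_max_def pseudo_optimal_def y[symmetric] by (auto simp: not_less)
    with y stationary_valid_pruned[OF assms HD opt nb]
      stationary_strictly_local_opt[OF assms HD opt nb] stationary_local_max[OF assms HD opt nb]
    show "(\<forall>s0. ystar s0 = mean M (det_policy ustar) s0 \<and>
              is_arg_max (\<lambda>u. Jhat M (det_policy u) s0 (ystar s0)) (\<lambda>u. u \<in> HD M) ustar) \<and>
        valid_pruned M (U_valid M ustar ystar) \<and>
        strictly_local_opt M (U_valid M ustar ystar) ustar \<and>
        (\<forall>s0. local_max_on (Y_range M) (Jhat_star M s0) (ystar s0))"
      unfolding ystar by blast
  qed
qed

end
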